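(* Let $(M,P,g)$ be a $\mathcal{W}_1$-manifold with $\dim M=2n$ and let $\nabla'$ be the natural connection on it determined by the pair of real parameters $(\lambda,\mu)$. The curvature tensor $R'$ of $\nabla'$ is a Riemannian $P$-tensor if and only if the following conditions hold for all $y,z$: $$U(y,z)-U(z,y)+\tfrac{\lambda}{2n}\{\theta(Py)\theta(z)-\theta(y)\theta(Pz)\}=0,$$ $$V(y,z)-V(z,y)+\tfrac{\mu}{2n}\{\theta(Py)\theta(z)-\theta(y)\theta(Pz)\}=0.$$
   Context: Setting. A Riemannian almost product manifold $(M,P,g)$ is a differentiable manifold $M$ with a $(1,1)$-tensor field $P$ and a Riemannian metric $g$ such that $P^2x=x$ and $g(Px,Py)=g(x,y)$. Throughout $\operatorname{tr}P=0$ and $\dim M=2n$; $x,y,z,w$ are arbitrary smooth vector fields (or tangent vectors). Let $\nabla$ be the Levi-Civita connection of $g$, $F(x,y,z)=g((\nabla_xP)y,z)$, and $\theta(x)=g^{ij}F(e_i,e_j,x)$, where $\{e_i\}$ is a basis of the tangent space and $(g^{ij})$ is the inverse matrix of $(g(e_i,e_j))$. $(M,P,g)$ is a $\mathcal{W}_1$-manifold if $$F(x,y,z)=\tfrac{1}{2n}\{g(x,y)\theta(z)-g(x,Py)\theta(Pz)+g(x,z)\theta(y)-g(x,Pz)\theta(Py)\}.$$ The vector field $\Omega$ is defined by $g(\Omega,x)=\theta(x)$. Natural connections. A linear connection $\nabla'$ is natural if $\nabla'P=\nabla'g=0$. The natural connections considered on a $\mathcal{W}_1$-manifold form a 2-parametric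 family with parameters $\lambda,\mu\in\mathbb{R}$; the one determined by $(\lambda,\mu)$ is $$\nabla'_xy=\nabla_xy+g(x,Py)\{\lambda P\Omega+\mu\Omega\}-\{\lambda\theta(Py)+\mu\theta(y)\}Px+g(x,y)\{\lambda\Omega+(\mu+\tfrac1{2n})P\Omega\}-\{\lambda\theta(y)+(\mu+\tfrac1{2n})\theta(Py)\}x.$$ Put $U(x,w)=\lambda(\nabla'_x\theta)w+(\mu+\frac1{2n})(\nabla'_x\theta)Pw$ and $V(x,w)=\lambda(\nabla'_x\theta)Pw+\mu(\nabla'_x\theta)w$. Curvature. $R'(x,y)z=\nabla'_x\nabla'_yz-\nabla'_y\nabla'_xz-\nabla'_{[x,y]}z$, $R'(x,y,z,w)=g(R'(x,y)z,w)$. A $(0,4)$-tensor $L$ is a Riemannian $P$-tensor if $L(x,y,z,w)=-L(y,x,z,w)=-L(x,y,w,z)$, $L(x,y,z,w)+L(y,z,x,w)+L(z,x,y,w)=0$, and $L(x,y,Pz,Pw)=L(x,y,z,w)$.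
   Formalization: The formal statement assumes n ≥ 2 (dim M ≥ 4); for dim M = 2 the "only if" direction is false, e.g. M = R^2, g = e^{2xy}dx^2 + dy^2, P = diag(1,-1), λ = μ = 0, where R' = 0 but the first condition fails. *)

theory Defs
  imports "HOL-Analysis.Analysis"
begin

section \<open>Smooth manifolds and vector fields\<close>

primrec Ck_on :: "nat \<Rightarrow> 'v::real_normed_vector set \<Rightarrow> ('v \<Rightarrow> 'w::real_normed_vector) \<Rightarrow> bool" where
  "Ck_on 0 S f \<longleftrightarrow> continuous_on S f"
| "Ck_on (Suc k) S f \<longleftrightarrow>
     (\<forall>x\<in>S. f differentiable (at x)) \<and> (\<forall>v. Ck_on k S (\<lambda>x. frechet_derivative f (at x) v))"

text \<open>Only used for open sets.\<close>
definition smooth_on :: "'v::real_normed_vector set \<Rightarrow> ('v \<Rightarrow> 'w::real_normed_vector) \<Rightarrow> bool" where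
  "smooth_on S f \<longleftrightarrow> (\<forall>k. Ck_on k S f)"

text \<open>A manifold is a whole type together with an atlas of charts into \<open>real^'m\<close>. A chart is a pair
  of its domain and its coordinate map; the values of the coordinate map off the domain are junk.\<close>
type_synonym ('a, 'm) chart = "'a set \<times> ('a \<Rightarrow> real^'m)"

abbreviation chart_image :: "('a, 'm) chart \<Rightarrow> (real^'m) set" where
  "chart_image c \<equiv> snd c ` fst c"

abbreviation chart_inv :: "('a, 'm) chart \<Rightarrow> real^'m \<Rightarrow> 'a" where
  "chart_inv c \<equiv> inv_into (fst c) (snd c)"

definition smooth_atlas ::
  "('a::{t2_space,second_countable_topology}, 'm::finite) chart set \<Rightarrow> bool" where
  "smooth_atlas A \<longleftrightarrow>
     (\<Union>c\<in>A. fst c) = UNIV \<and>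
     (\<forall>c\<in>A. open (fst c) \<and> open (chart_image c) \<and>
             homeomorphism (fst c) (chart_image c) (snd c) (chart_inv c)) \<and>
     (\<forall>c\<in>A. \<forall>d\<in>A. smooth_on (snd c ` (fst c \<inter> fst d)) (snd d \<circ> chart_inv c))"

definition chart_at :: "('a, 'm) chart set \<Rightarrow> 'a \<Rightarrow> ('a, 'm) chart" where
  "chart_at A p = (SOME c. c \<in> A \<and> p \<in> fst c)"

text \<open>The tangent space at \<open>p\<close> is \<open>real^'m\<close>, a tangent vector being given by its components in the
  fixed chart \<open>chart_at A p\<close>. Its components in any other chart \<open>c\<close> around \<open>p\<close> are obtained by
  the differential of the change of coordinates.\<close>
definition components ::
  "('a, 'm::finite) chart set \<Rightarrow> ('a, 'm) chart \<Rightarrow> 'a \<Rightarrow> real^'m \<Rightarrow> real^'m" where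
  "components A c p v =
     frechet_derivative (snd c \<circ> chart_inv (chart_at A p)) (at (snd (chart_at A p) p)) v"

type_synonym ('a, 'm) field = "'a \<Rightarrow> real^'m"

text \<open>A vector field in the coordinates of a chart.\<close>
definition coord_field ::
  "('a, 'm::finite) chart set \<Rightarrow> ('a, 'm) chart \<Rightarrow> ('a, 'm) field \<Rightarrow> real^'m \<Rightarrow> real^'m" where
  "coord_field A c X = (\<lambda>u. components A c (chart_inv c u) (X (chart_inv c u)))"

definition smooth_fun :: "('a, 'm::finite) chart set \<Rightarrow> ('a \<Rightarrow> real) \<Rightarrow> bool" where
  "smooth_fun A f \<longleftrightarrow> (\<forall>c\<in>A. smooth_on (chart_image c) (f \<circ> chart_inv c))"

definition smooth_field :: "('a, 'm::finite) chart set \<Rightarrow> ('a, 'm) field \<Rightarrow> bool" where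
  "smooth_field A X \<longleftrightarrow> (\<forall>c\<in>A. smooth_on (chart_image c) (coord_field A c X))"

text \<open>The derivative \<open>X f\<close> of a function along a vector field.\<close>
definition dir_deriv ::
  "('a, 'm::finite) chart set \<Rightarrow> ('a, 'm) field \<Rightarrow> ('a \<Rightarrow> real) \<Rightarrow> 'a \<Rightarrow> real" where
  "dir_deriv A X f p =
     frechet_derivative (f \<circ> chart_inv (chart_at A p)) (at (snd (chart_at A p) p)) (X p)"

text \<open>In coordinates, the \<open>k\<close>-th component of \<open>[X,Y]\<close> is
  the sum over \<open>i\<close> of \<open>X\<^sup>i \<partial>\<^sub>i Y\<^sup>k - Y\<^sup>i \<partial>\<^sub>i X\<^sup>k\<close>.\<close>
definition lie_bracket ::
  "('a, 'm::finite) chart set \<Rightarrow> ('a, 'm) field \<Rightarrow> ('a, 'm) field \<Rightarrow> ('a, 'm) field" where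
  "lie_bracket A X Y p =
     (let c = chart_at A p; u = snd c p in
       frechet_derivative (coord_field A c Y) (at u) (X p)
       - frechet_derivative (coord_field A c X) (at u) (Y p))"

section \<open>Tensor fields, metrics and connections\<close>

text \<open>Tensor fields of type (1,1) and (0,2) are given pointwise on tangent vectors.\<close>
type_synonym ('a, 'm) tensor11 = "'a \<Rightarrow> real^'m \<Rightarrow> real^'m"
type_synonym ('a, 'm) tensor02 = "'a \<Rightarrow> real^'m \<Rightarrow> real^'m \<Rightarrow> real"
type_synonym ('a, 'm) form = "('a, 'm) field \<Rightarrow> 'a \<Rightarrow> real"
type_synonym ('a, 'm) conn = "('a, 'm) field \<Rightarrow> ('a, 'm) field \<Rightarrow> ('a, 'm) field"

definition app11 :: "('a, 'm) tensor11 \<Rightarrow> ('a, 'm) field \<Rightarrow> ('a, 'm) field" where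
  "app11 P X = (\<lambda>p. P p (X p))"

definition app02 :: "('a, 'm) tensor02 \<Rightarrow> ('a, 'm) field \<Rightarrow> ('a, 'm) field \<Rightarrow> 'a \<Rightarrow> real" where
  "app02 g X Y = (\<lambda>p. g p (X p) (Y p))"

definition smooth_tensor11 ::
  "('a, 'm::finite) chart set \<Rightarrow> ('a, 'm) tensor11 \<Rightarrow> bool" where
  "smooth_tensor11 A P \<longleftrightarrow>
     (\<forall>p. linear (P p)) \<and> (\<forall>X. smooth_field A X \<longrightarrow> smooth_field A (app11 P X))"

definition riemannian_metric ::
  "('a, 'm::finite) chart set \<Rightarrow> ('a, 'm) tensor02 \<Rightarrow> bool" where
  "riemannian_metric A g \<longleftrightarrow>
     (\<forall>p. bilinear (g p) \<and> (\<forall>v w. g p v w = g p w v) \<and> (\<forall>v. v \<noteq> 0 \<longrightarrow> g p v v > 0)) \<and>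
     (\<forall>X Y. smooth_field A X \<longrightarrow> smooth_field A Y \<longrightarrow> smooth_fun A (app02 g X Y))"

text \<open>Linearity over the ring of smooth functions.\<close>
definition tensorial :: "('a, 'm::finite) chart set \<Rightarrow> ('a, 'm) form \<Rightarrow> bool" where
  "tensorial A T \<longleftrightarrow>
     (\<forall>X. smooth_field A X \<longrightarrow> smooth_fun A (T X)) \<and>
     (\<forall>X Y. smooth_field A X \<longrightarrow> smooth_field A Y \<longrightarrow>
        T (\<lambda>p. X p + Y p) = (\<lambda>p. T X p + T Y p)) \<and>
     (\<forall>f X. smooth_fun A f \<longrightarrow> smooth_field A X \<longrightarrow>
        T (\<lambda>p. f p *\<^sub>R X p) = (\<lambda>p. f p * T X p))"

type_synonym ('a, 'm) tensor04 =
  "('a, 'm) field \<Rightarrow> ('a, 'm) field \<Rightarrow> ('a, 'm) field \<Rightarrow> ('a, 'm) field \<Rightarrow> 'a \<Rightarrow> real"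

definition tensor_field04 :: "('a, 'm::finite) chart set \<Rightarrow> ('a, 'm) tensor04 \<Rightarrow> bool" where
  "tensor_field04 A L \<longleftrightarrow>
     (\<forall>X Y Z. smooth_field A X \<longrightarrow> smooth_field A Y \<longrightarrow> smooth_field A Z \<longrightarrow>
        tensorial A (\<lambda>W. L W X Y Z) \<and> tensorial A (\<lambda>W. L X W Y Z) \<and>
        tensorial A (\<lambda>W. L X Y W Z) \<and> tensorial A (\<lambda>W. L X Y Z W))"

definition linear_connection :: "('a, 'm::finite) chart set \<Rightarrow> ('a, 'm) conn \<Rightarrow> bool" where
  "linear_connection A nab \<longleftrightarrow>
     (\<forall>X Y. smooth_field A X \<longrightarrow> smooth_field A Y \<longrightarrow> smooth_field A (nab X Y)) \<and>
     (\<forall>X X' Y. smooth_field A X \<longrightarrow> smooth_field A X' \<longrightarrow> smooth_field A Y \<longrightarrow>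
        nab (\<lambda>p. X p + X' p) Y = (\<lambda>p. nab X Y p + nab X' Y p)) \<and>
     (\<forall>X Y Y'. smooth_field A X \<longrightarrow> smooth_field A Y \<longrightarrow> smooth_field A Y' \<longrightarrow>
        nab X (\<lambda>p. Y p + Y' p) = (\<lambda>p. nab X Y p + nab X Y' p)) \<and>
     (\<forall>f X Y. smooth_fun A f \<longrightarrow> smooth_field A X \<longrightarrow> smooth_field A Y \<longrightarrow>
        nab (\<lambda>p. f p *\<^sub>R X p) Y = (\<lambda>p. f p *\<^sub>R nab X Y p)) \<and>
     (\<forall>f X Y. smooth_fun A f \<longrightarrow> smooth_field A X \<longrightarrow> smooth_field A Y \<longrightarrow>
        nab X (\<lambda>p. f p *\<^sub>R Y p) = (\<lambda>p. dir_deriv A X f p *\<^sub>R Y p + f p *\<^sub>R nab X Y p))"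

definition levi_civita ::
  "('a, 'm::finite) chart set \<Rightarrow> ('a, 'm) tensor02 \<Rightarrow> ('a, 'm) conn \<Rightarrow> bool" where
  "levi_civita A g nab \<longleftrightarrow>
     linear_connection A nab \<and>
     (\<forall>X Y. smooth_field A X \<longrightarrow> smooth_field A Y \<longrightarrow>
        (\<lambda>p. nab X Y p - nab Y X p) = lie_bracket A X Y) \<and>
     (\<forall>X Y Z. smooth_field A X \<longrightarrow> smooth_field A Y \<longrightarrow> smooth_field A Z \<longrightarrow>
        dir_deriv A X (app02 g Y Z) =
          (\<lambda>p. app02 g (nab X Y) Z p + app02 g Y (nab X Z) p))"

text \<open>The covariant derivatives of a (1,1)-tensor field and of a 1-form:
  \<open>(\<nabla>\<^sub>X P) Y\<close> and \<open>(\<nabla>\<^sub>X \<theta>) Y\<close>.\<close>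
definition cov_deriv11 ::
  "('a, 'm::finite) conn \<Rightarrow> ('a, 'm) tensor11 \<Rightarrow> ('a, 'm) field \<Rightarrow> ('a, 'm) field \<Rightarrow> ('a, 'm) field" where
  "cov_deriv11 nab P X Y = (\<lambda>p. nab X (app11 P Y) p - app11 P (nab X Y) p)"

definition cov_deriv_form ::
  "('a, 'm::finite) chart set \<Rightarrow> ('a, 'm) conn \<Rightarrow> ('a, 'm) form \<Rightarrow>
    ('a, 'm) field \<Rightarrow> ('a, 'm) field \<Rightarrow> 'a \<Rightarrow> real" where
  "cov_deriv_form A nab \<theta> X Y = (\<lambda>p. dir_deriv A X (\<theta> Y) p - \<theta> (nab X Y) p)"

definition curvature ::
  "('a, 'm::finite) chart set \<Rightarrow> ('a, 'm) conn \<Rightarrow>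
    ('a, 'm) field \<Rightarrow> ('a, 'm) field \<Rightarrow> ('a, 'm) field \<Rightarrow> ('a, 'm) field" where
  "curvature A nab X Y Z =
     (\<lambda>p. nab X (nab Y Z) p - nab Y (nab X Z) p - nab (lie_bracket A X Y) Z p)"

definition curvature04 ::
  "('a, 'm::finite) chart set \<Rightarrow> ('a, 'm) tensor02 \<Rightarrow> ('a, 'm) conn \<Rightarrow> ('a, 'm) tensor04" where
  "curvature04 A g nab X Y Z W = app02 g (curvature A nab X Y Z) W"

section \<open>Riemannian almost product manifolds\<close>

definition almost_product_manifold ::
  "('a::{t2_space,second_countable_topology}, 'm::finite) chart set \<Rightarrow> nat \<Rightarrow>
    ('a, 'm) tensor11 \<Rightarrow> ('a, 'm) tensor02 \<Rightarrow> bool" where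
  "almost_product_manifold A n P g \<longleftrightarrow>
     smooth_atlas A \<and> CARD('m) = 2 * n \<and> smooth_tensor11 A P \<and> riemannian_metric A g \<and>
     (\<forall>p v. P p (P p v) = v) \<and> (\<forall>p v w. g p (P p v) (P p w) = g p v w) \<and>
     (\<forall>p. trace (matrix (P p)) = 0)"

definition tensor_F ::
  "('a, 'm::finite) tensor11 \<Rightarrow> ('a, 'm) tensor02 \<Rightarrow> ('a, 'm) conn \<Rightarrow>
    ('a, 'm) field \<Rightarrow> ('a, 'm) field \<Rightarrow> ('a, 'm) field \<Rightarrow> 'a \<Rightarrow> real" where
  "tensor_F P g nab X Y Z = app02 g (cov_deriv11 nab P X Y) Z"

text \<open>A global smooth vector field through a given tangent vector; it always exists on a smooth
  manifold. It serves to evaluate the tensor \<open>F\<close> on tangent vectors, which does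
  not depend on the choice.\<close>
definition extension :: "('a, 'm::finite) chart set \<Rightarrow> 'a \<Rightarrow> real^'m \<Rightarrow> ('a, 'm) field" where
  "extension A p v = (SOME X. smooth_field A X \<and> X p = v)"

definition metric_matrix :: "('a, 'm::finite) tensor02 \<Rightarrow> 'a \<Rightarrow> real^'m^'m" where
  "metric_matrix g p = (\<chi> i j. g p (axis i 1) (axis j 1))"

text \<open>The contraction is taken in the coordinate basis \<open>axis i 1\<close> of the tangent space;
  its value is the same for every basis.\<close>
definition lee_form ::
  "('a, 'm::finite) chart set \<Rightarrow> ('a, 'm) tensor11 \<Rightarrow> ('a, 'm) tensor02 \<Rightarrow> ('a, 'm) conn \<Rightarrow>
    ('a, 'm) form" where
  "lee_form A P g nab X p =
     (\<Sum>i\<in>UNIV. \<Sum>j\<in>UNIV. matrix_inv (metric_matrix g p) $ i $ j *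
        tensor_F P g nab (extension A p (axis i 1)) (extension A p (axis j 1)) X p)"

definition W1_manifold ::
  "('a::{t2_space,second_countable_topology}, 'm::finite) chart set \<Rightarrow> nat \<Rightarrow>
    ('a, 'm) tensor11 \<Rightarrow> ('a, 'm) tensor02 \<Rightarrow> ('a, 'm) conn \<Rightarrow> bool" where
  "W1_manifold A n P g nab \<longleftrightarrow>
     almost_product_manifold A n P g \<and> levi_civita A g nab \<and>
     (let \<theta> = lee_form A P g nab in
      \<forall>X Y Z. smooth_field A X \<longrightarrow> smooth_field A Y \<longrightarrow> smooth_field A Z \<longrightarrow>
        (\<forall>p. tensor_F P g nab X Y Z p = 1 / (2 * real n) *
           (app02 g X Y p * \<theta> Z p - app02 g X (app11 P Y) p * \<theta> (app11 P Z) p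
            + app02 g X Z p * \<theta> Y p - app02 g X (app11 P Z) p * \<theta> (app11 P Y) p)))"

definition dual_field ::
  "('a, 'm::finite) chart set \<Rightarrow> ('a, 'm) tensor02 \<Rightarrow> ('a, 'm) form \<Rightarrow> ('a, 'm) field \<Rightarrow> bool" where
  "dual_field A g \<theta> \<Omega> \<longleftrightarrow>
     smooth_field A \<Omega> \<and> (\<forall>X. smooth_field A X \<longrightarrow> app02 g \<Omega> X = \<theta> X)"

definition natural_conn ::
  "nat \<Rightarrow> ('a, 'm::finite) tensor11 \<Rightarrow> ('a, 'm) tensor02 \<Rightarrow> ('a, 'm) conn \<Rightarrow>
    ('a, 'm) form \<Rightarrow> ('a, 'm) field \<Rightarrow> real \<Rightarrow> real \<Rightarrow> ('a, 'm) conn" where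
  "natural_conn n P g nab \<theta> \<Omega> lam \<mu> X Y = (\<lambda>p.
     nab X Y p
     + app02 g X (app11 P Y) p *\<^sub>R (lam *\<^sub>R app11 P \<Omega> p + \<mu> *\<^sub>R \<Omega> p)
     - (lam * \<theta> (app11 P Y) p + \<mu> * \<theta> Y p) *\<^sub>R app11 P X p
     + app02 g X Y p *\<^sub>R (lam *\<^sub>R \<Omega> p + (\<mu> + 1 / (2 * real n)) *\<^sub>R app11 P \<Omega> p)
     - (lam * \<theta> Y p + (\<mu> + 1 / (2 * real n)) * \<theta> (app11 P Y) p) *\<^sub>R X p)"

definition tensor_U ::
  "('a, 'm::finite) chart set \<Rightarrow> nat \<Rightarrow> ('a, 'm) tensor11 \<Rightarrow> ('a, 'm) conn \<Rightarrow> ('a, 'm) form \<Rightarrow>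
    real \<Rightarrow> real \<Rightarrow> ('a, 'm) field \<Rightarrow> ('a, 'm) field \<Rightarrow> 'a \<Rightarrow> real" where
  "tensor_U A n P nab' \<theta> lam \<mu> X W = (\<lambda>p.
     lam * cov_deriv_form A nab' \<theta> X W p
     + (\<mu> + 1 / (2 * real n)) * cov_deriv_form A nab' \<theta> X (app11 P W) p)"

definition tensor_V ::
  "('a, 'm::finite) chart set \<Rightarrow> ('a, 'm) tensor11 \<Rightarrow> ('a, 'm) conn \<Rightarrow> ('a, 'm) form \<Rightarrow>
    real \<Rightarrow> real \<Rightarrow> ('a, 'm) field \<Rightarrow> ('a, 'm) field \<Rightarrow> 'a \<Rightarrow> real" where
  "tensor_V A P nab' \<theta> lam \<mu> X W = (\<lambda>p.
     lam * cov_deriv_form A nab' \<theta> X (app11 P W) p + \<mu> * cov_deriv_form A nab' \<theta> X W p)"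

definition riemannian_P_tensor ::
  "('a, 'm::finite) chart set \<Rightarrow> ('a, 'm) tensor11 \<Rightarrow> ('a, 'm) tensor04 \<Rightarrow> bool" where
  "riemannian_P_tensor A P L \<longleftrightarrow>
     tensor_field04 A L \<and>
     (\<forall>X Y Z W. smooth_field A X \<longrightarrow> smooth_field A Y \<longrightarrow> smooth_field A Z \<longrightarrow> smooth_field A W \<longrightarrow>
        (\<forall>p. L X Y Z W p = - L Y X Z W p \<and>
             L X Y Z W p = - L X Y W Z p \<and>
             L X Y Z W p + L Y Z X W p + L Z X Y W p = 0 \<and>
             L X Y (app11 P Z) (app11 P W) p = L X Y Z W p))"

end

theory Submission
  imports Defs
begin

text \<open>Write \<open>\<nu> = \<mu> + 1/(2n)\<close>, and let \<open>\<alpha> = \<lambda> P \<Omega> + \<mu> \<Omega>\<close> and \<open>\<beta> = \<lambda> \<Omega> + \<nu> P \<Omega>\<close>. The connection \<open>\<nabla>'\<close> differs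
  from the Levi-Civita connection by the tensor
  \<open>g(x, P y) \<alpha> - g(\<alpha>, y) P x + g(x, y) \<beta> - g(\<beta>, y) x\<close>. It is skew-adjoint in \<open>y\<close>, so \<open>\<nabla>' g = 0\<close>, and
  its commutator with \<open>P\<close> is exactly the negative of the expression for \<open>\<nabla> P\<close> that defines the class W1, so
  \<open>\<nabla>' P = 0\<close>. Hence the curvature \<open>R'\<close> is always skew in its last two arguments and invariant
  under \<open>P\<close> in them. Of the properties of a Riemannian \<open>P\<close>-tensor only the Bianchi identity
  remains to be discussed.

  The torsion of \<open>\<nabla>'\<close> is
  \<open>T(x, y) = g(\<alpha>, x) P y - g(\<alpha>, y) P x + g(\<beta>, x) y - g(\<beta>, y) x\<close>.
  For a connection with torsion the cyclic sum of \<open>R'(x, y) z\<close> is that of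
  \<open>(\<nabla>'_x T)(y, z) + T(T(x, y), z)\<close>. As \<open>U(x, w) = g(\<nabla>'_x \<beta>, w)\<close> and \<open>V(x, w) = g(\<nabla>'_x \<alpha>, w)\<close>, the
  computation (\<open>bianchi_sum\<close>) gives the cyclic sum of \<open>V'(x, y) P z + U'(x, y) z\<close>, where \<open>U'\<close> and
  \<open>V'\<close> are the left-hand sides of the two conditions. This settles one direction.

  For the converse split all fields into eigenfields of \<open>P\<close>. On a pair of fields from the same
  eigenbundle \<open>U'\<close> and \<open>V'\<close> vanish unconditionally (\<open>forms_vanish_on_eigenfields\<close>): pair the cyclic
  sum with a third field \<open>z\<close> of the other eigenbundle; the curvature terms disappear because \<open>R'\<close> is
  skew and commutes with \<open>P\<close>, and the resulting relation between \<open>U'\<close> and \<open>V'\<close>, which are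
  multiples of the same number here, leaves only zero. On a mixed pair \<open>x, y\<close> the Bianchi identity, evaluated with a third
  field \<open>z\<close> of the eigenbundle of \<open>y\<close> that is not proportional to \<open>y\<close>, forces one of the
  combinations \<open>U' + V'\<close>, \<open>U' - V'\<close> to vanish, and exchanging the eigenbundles gives the other one
  (\<open>forms_vanish\<close>). Such a \<open>z\<close> exists since \<open>P\<close> is traceless, so that both eigenbundles have rank
  \<open>n \<ge> 2\<close>.

  The analytic part supplies what these arguments take from manifold theory: the identity
  \<open>[X, Y] f = X (Y f) - Y (X f)\<close>, which rests on the symmetry of second derivatives; bump functions,
  and with them global vector fields through given tangent vectors; the Jacobi identity; and the
  tensoriality of the curvature.\<close>

section \<open>Calculus of smooth maps\<close>

lemma Ck_on_cong:
  fixes f g :: "'v::real_normed_vector \<Rightarrow> 'w::real_normed_vector"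
  assumes "open S" "\<And>x. x \<in> S \<Longrightarrow> f x = g x"
  shows "Ck_on k S f \<longleftrightarrow> Ck_on k S g"
  using assms(2)
proof (induction k arbitrary: f g)
  case 0
  then show ?case by (simp cong: continuous_on_cong)
next
  case (Suc k)
  have *: "Ck_on (Suc k) S h" if f: "Ck_on (Suc k) S f" and eq: "\<And>x. x \<in> S \<Longrightarrow> f x = h x"
    for f h :: "'v \<Rightarrow> 'w"
  proof -
    have d: "(h has_derivative frechet_derivative f (at x)) (at x)" if "x \<in> S" for x
      using has_derivative_transform_within_open[OF _ \<open>open S\<close> that, of f _ UNIV h] eq f that
      by (simp add: frechet_derivative_works)
    have e: "frechet_derivative h (at x) = frechet_derivative f (at x)" if "x \<in> S" for x
      using frechet_derivative_at[OF d[OF that]] by simp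
    have "Ck_on k S (\<lambda>x. frechet_derivative h (at x) v)" for v
      using Suc.IH[of "\<lambda>x. frechet_derivative h (at x) v" "\<lambda>x. frechet_derivative f (at x) v"] f e by simp
    then show ?thesis using d by (auto simp: differentiable_def)
  qed
  show ?case by (rule iffI; erule *) (simp_all add: Suc.prems)
qed

lemma Ck_on_Suc_imp: "Ck_on (Suc k) S f \<Longrightarrow> Ck_on k S f"
proof (induction k arbitrary: f)
  case 0
  then show ?case
    by (auto intro!: continuous_at_imp_continuous_on differentiable_imp_continuous_within)
next
  case (Suc k)
  have "Ck_on k S (\<lambda>x. frechet_derivative f (at x) v)" for v
    using Suc.prems by (intro Suc.IH) simp
  then show ?case using Suc.prems by simp
qed

lemma Ck_on_has_derivative:
  "Ck_on (Suc k) S f \<Longrightarrow> x \<in> S \<Longrightarrow> (f has_derivative frechet_derivative f (at x)) (at x)"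
  by (simp add: frechet_derivative_works[symmetric])

lemma Ck_on_local:
  assumes "\<And>x. x \<in> S \<Longrightarrow> \<exists>U. open U \<and> x \<in> U \<and> Ck_on k (S \<inter> U) f" "open S"
  shows "Ck_on k S f"
  using assms
proof (induction k arbitrary: f)
  case 0
  have "isCont f x" if "x \<in> S" for x
  proof -
    from 0(1)[OF that] obtain U where "open U" "x \<in> U" "continuous_on (S \<inter> U) f" by auto
    then show ?thesis using that \<open>open S\<close> by (auto simp: continuous_on_eq_continuous_at open_Int)
  qed
  then show ?case by (simp add: continuous_at_imp_continuous_on)
next
  case (Suc k)
  have "f differentiable at x" if "x \<in> S" for x
  proof -
    from Suc.prems(1)[OF that] obtain U where "x \<in> U" "Ck_on (Suc k) (S \<inter> U) f" by blast
    then show ?thesis using that by simp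
  qed
  moreover have "Ck_on k S (\<lambda>x. frechet_derivative f (at x) v)" for v
  proof (rule Suc.IH[OF _ Suc.prems(2)])
    fix x assume "x \<in> S"
    from Suc.prems(1)[OF this] obtain U where "open U" "x \<in> U" "Ck_on (Suc k) (S \<inter> U) f" by blast
    then show "\<exists>U. open U \<and> x \<in> U \<and> Ck_on k (S \<inter> U) (\<lambda>x. frechet_derivative f (at x) v)"
      by (intro exI[of _ U]) simp
  qed
  ultimately show ?case by simp
qed

lemma Ck_on_const: "Ck_on k S (\<lambda>x. c)"
  by (induction k arbitrary: c) auto

lemma Ck_on_bounded_linear:
  assumes "bounded_linear L" "Ck_on k S f" "open S"
  shows "Ck_on k S (\<lambda>x. L (f x))"
  using assms(2)
proof (induction k arbitrary: f)
  case 0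
  then show ?case using assms(1) by (simp add: bounded_linear.continuous_on)
next
  case (Suc k)
  have d: "((\<lambda>x. L (f x)) has_derivative (\<lambda>v. L (frechet_derivative f (at x) v))) (at x)" if "x \<in> S" for x
    by (rule bounded_linear.has_derivative[OF assms(1) Ck_on_has_derivative[OF Suc.prems that]])
  have e: "frechet_derivative (\<lambda>x. L (f x)) (at x) = (\<lambda>v. L (frechet_derivative f (at x) v))" if "x \<in> S" for x
    using frechet_derivative_at[OF d[OF that]] by simp
  have "Ck_on k S (\<lambda>x. frechet_derivative (\<lambda>x. L (f x)) (at x) v)" for v
    using Suc.IH[of "\<lambda>x. frechet_derivative f (at x) v"] Suc.prems e
    by (subst Ck_on_cong[OF assms(3)]) auto
  then show ?case using d by (auto simp: differentiable_def)
qed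

lemma Ck_on_add:
  assumes "Ck_on k S f" "Ck_on k S g" "open S"
  shows "Ck_on k S (\<lambda>x. f x + g x)"
  using assms(1,2)
proof (induction k arbitrary: f g)
  case 0
  then show ?case by (simp add: continuous_on_add)
next
  case (Suc k)
  have d: "((\<lambda>x. f x + g x) has_derivative (\<lambda>v. frechet_derivative f (at x) v + frechet_derivative g (at x) v)) (at x)"
    if "x \<in> S" for x
    by (rule has_derivative_add[OF Suc.prems[THEN Ck_on_has_derivative, OF that]])
  have e: "frechet_derivative (\<lambda>x. f x + g x) (at x) = (\<lambda>v. frechet_derivative f (at x) v + frechet_derivative g (at x) v)"
    if "x \<in> S" for x
    using frechet_derivative_at[OF d[OF that]] by simp
  have "Ck_on k S (\<lambda>x. frechet_derivative (\<lambda>x. f x + g x) (at x) v)" for v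
    using Suc.IH Suc.prems e
    by (subst Ck_on_cong[OF assms(3)]) auto
  then show ?case using d by (auto simp: differentiable_def)
qed

lemma Ck_on_sum:
  assumes "\<And>i. i \<in> I \<Longrightarrow> Ck_on k S (f i)" "open S"
  shows "Ck_on k S (\<lambda>x. \<Sum>i\<in>I. f i x)"
  using assms(1)
  by (induction I rule: infinite_finite_induct) (auto simp: Ck_on_const assms(2) intro!: Ck_on_add)

lemma Ck_on_bilinear:
  assumes bil: "bounded_bilinear B" and "Ck_on k S f" "Ck_on k S g" "open S"
  shows "Ck_on k S (\<lambda>x. B (f x) (g x))"
  using assms(2,3)
proof (induction k arbitrary: f g)
  case 0
  then show ?case by (simp add: bounded_bilinear.continuous_on[OF bil])
next
  case (Suc k)
  let ?D = "\<lambda>x v. B (f x) (frechet_derivative g (at x) v) + B (frechet_derivative f (at x) v) (g x)"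
  have d: "((\<lambda>x. B (f x) (g x)) has_derivative ?D x) (at x)" if "x \<in> S" for x
    by (rule bounded_bilinear.FDERIV[OF bil Suc.prems[THEN Ck_on_has_derivative, OF that]])
  have e: "frechet_derivative (\<lambda>x. B (f x) (g x)) (at x) = ?D x" if "x \<in> S" for x
    using frechet_derivative_at[OF d[OF that]] by simp
  have "Ck_on k S (\<lambda>x. ?D x v)" for v
    using Suc.prems Ck_on_Suc_imp[OF Suc.prems(1)] Ck_on_Suc_imp[OF Suc.prems(2)]
    by (auto intro!: Ck_on_add Suc.IH assms(4))
  then have "Ck_on k S (\<lambda>x. frechet_derivative (\<lambda>x. B (f x) (g x)) (at x) v)" for v
    using e by (subst Ck_on_cong[OF assms(4)]) auto
  then show ?case using d by (auto simp: differentiable_def)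
qed

text \<open>The induction on the order of differentiability needs the derivative of the outer map in
  finitely many fixed directions only, so the intermediate space is taken to be Euclidean.\<close>
lemma Ck_on_compose:
  fixes g :: "'u::real_normed_vector \<Rightarrow> 'v::euclidean_space"
    and f :: "'v \<Rightarrow> 'w::real_normed_vector"
  assumes "Ck_on k T f" "Ck_on k S g" "open S" "g ` S \<subseteq> T"
  shows "Ck_on k S (\<lambda>x. f (g x))"
  using assms(1,2)
proof (induction k arbitrary: f)
  case 0
  then show ?case using assms(4) by (auto intro: continuous_on_compose2)
next
  case (Suc k)
  let ?f = "\<lambda>y. frechet_derivative f (at y)" and ?g = "\<lambda>y. frechet_derivative g (at y)"
  have d: "((\<lambda>x. f (g x)) has_derivative (\<lambda>v. ?f (g x) (?g x v))) (at x)" if "x \<in> S" for x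
  proof -
    have "(g has_derivative ?g x) (at x)" "(f has_derivative ?f (g x)) (at (g x))"
      using Suc.prems that assms(4) by (auto simp: frechet_derivative_works[symmetric])
    then show ?thesis by (rule has_derivative_compose)
  qed
  have e: "frechet_derivative (\<lambda>x. f (g x)) (at x) v = (\<Sum>b\<in>Basis. (?g x v \<bullet> b) *\<^sub>R ?f (g x) b)"
    if "x \<in> S" for x v
  proof -
    have lin: "linear (?f (g x))"
      using Suc.prems that assms(4) by (auto intro!: linear_frechet_derivative)
    have "frechet_derivative (\<lambda>x. f (g x)) (at x) v = ?f (g x) (?g x v)"
      using frechet_derivative_at[OF d[OF that]] by metis
    also have "\<dots> = ?f (g x) (\<Sum>b\<in>Basis. (?g x v \<bullet> b) *\<^sub>R b)" by (simp add: euclidean_representation)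
    also have "\<dots> = (\<Sum>b\<in>Basis. (?g x v \<bullet> b) *\<^sub>R ?f (g x) b)"
      using lin by (simp add: linear_sum linear_scale)
    finally show ?thesis .
  qed
  have "Ck_on k S (\<lambda>x. (?g x v \<bullet> b) *\<^sub>R ?f (g x) b)" for v b
  proof (rule Ck_on_bilinear[OF bounded_bilinear_scaleR])
    show "Ck_on k S (\<lambda>x. ?g x v \<bullet> b)"
      using Suc.prems by (auto intro!: Ck_on_bounded_linear[OF bounded_linear_inner_left] assms(3))
    show "Ck_on k S (\<lambda>x. ?f (g x) b)"
      using Suc.prems Ck_on_Suc_imp[OF Suc.prems(2)] by (auto intro!: Suc.IH[of "\<lambda>y. ?f y b"])
  qed (rule assms(3))
  then have "Ck_on k S (\<lambda>x. frechet_derivative (\<lambda>x. f (g x)) (at x) v)" for v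
    using e by (subst Ck_on_cong[OF assms(3)]) (auto intro!: Ck_on_sum assms(3))
  then show ?case using d by (auto simp: differentiable_def)
qed

lemma smooth_on_cong: "open S \<Longrightarrow> (\<And>x. x \<in> S \<Longrightarrow> f x = g x) \<Longrightarrow> smooth_on S f \<longleftrightarrow> smooth_on S g"
  unfolding smooth_on_def using Ck_on_cong[of S f g] by auto

lemma smooth_on_Un:
  assumes "smooth_on S f" "smooth_on T f" "open S" "open T"
  shows "smooth_on (S \<union> T) f"
  unfolding smooth_on_def
proof (intro allI Ck_on_local)
  fix k x assume "x \<in> S \<union> T"
  moreover have "Ck_on k ((S \<union> T) \<inter> S) f" "Ck_on k ((S \<union> T) \<inter> T) f"
    using assms by (auto simp: smooth_on_def Int_absorb1)
  ultimately show "\<exists>U. open U \<and> x \<in> U \<and> Ck_on k ((S \<union> T) \<inter> U) f" using assms by blast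
qed (use assms in auto)

lemma smooth_on_const: "smooth_on S (\<lambda>x. c)"
  by (simp add: smooth_on_def Ck_on_const)

lemma smooth_on_bounded_linear:
  "bounded_linear L \<Longrightarrow> smooth_on S f \<Longrightarrow> open S \<Longrightarrow> smooth_on S (\<lambda>x. L (f x))"
  by (simp add: smooth_on_def Ck_on_bounded_linear)

lemma smooth_on_add:
  "smooth_on S f \<Longrightarrow> smooth_on S g \<Longrightarrow> open S \<Longrightarrow> smooth_on S (\<lambda>x. f x + g x)"
  by (simp add: smooth_on_def Ck_on_add)

lemma smooth_on_sum:
  "(\<And>i. i \<in> I \<Longrightarrow> smooth_on S (f i)) \<Longrightarrow> open S \<Longrightarrow> smooth_on S (\<lambda>x. \<Sum>i\<in>I. f i x)"
  by (simp add: smooth_on_def Ck_on_sum)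

lemma smooth_on_bilinear:
  "bounded_bilinear B \<Longrightarrow> smooth_on S f \<Longrightarrow> smooth_on S g \<Longrightarrow> open S \<Longrightarrow>
    smooth_on S (\<lambda>x. B (f x) (g x))"
  by (simp add: smooth_on_def Ck_on_bilinear)

lemmas smooth_on_scaleR = smooth_on_bilinear[OF bounded_bilinear_scaleR]
  and smooth_on_mult = smooth_on_bilinear[OF bounded_bilinear_mult]

lemma smooth_on_compose:
  fixes g :: "'u::real_normed_vector \<Rightarrow> 'v::euclidean_space"
  assumes "smooth_on T f" "smooth_on S g" "open S" "g ` S \<subseteq> T"
  shows "smooth_on S (\<lambda>x. f (g x))"
  using Ck_on_compose[OF _ _ assms(3,4)] assms(1,2) by (auto simp: smooth_on_def)

lemma smooth_on_imp_differentiable: "smooth_on S f \<Longrightarrow> x \<in> S \<Longrightarrow> f differentiable (at x)"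
  unfolding smooth_on_def by (auto dest: spec[of _ "Suc 0"])

lemma smooth_on_has_derivative:
  "smooth_on S f \<Longrightarrow> x \<in> S \<Longrightarrow> (f has_derivative frechet_derivative f (at x)) (at x)"
  using smooth_on_imp_differentiable frechet_derivative_works by blast

lemma smooth_on_derivative: "smooth_on S f \<Longrightarrow> smooth_on S (\<lambda>x. frechet_derivative f (at x) v)"
  unfolding smooth_on_def
proof
  fix k assume "\<forall>k. Ck_on k S f"
  then have "Ck_on (Suc k) S f" ..
  then show "Ck_on k S (\<lambda>x. frechet_derivative f (at x) v)" by simp
qed

lemma smooth_on_derivative_along:
  fixes f :: "'v::euclidean_space \<Rightarrow> 'w::real_normed_vector"
  assumes "smooth_on S f" "smooth_on S X" "open S"
  shows "smooth_on S (\<lambda>x. frechet_derivative f (at x) (X x))"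
proof -
  have "frechet_derivative f (at x) (X x) = (\<Sum>b\<in>Basis. (X x \<bullet> b) *\<^sub>R frechet_derivative f (at x) b)"
    if "x \<in> S" for x
  proof -
    have lin: "linear (frechet_derivative f (at x))"
      using smooth_on_imp_differentiable[OF assms(1) that] by (rule linear_frechet_derivative)
    have "frechet_derivative f (at x) (X x) = frechet_derivative f (at x) (\<Sum>b\<in>Basis. (X x \<bullet> b) *\<^sub>R b)"
      by (simp add: euclidean_representation)
    then show ?thesis using lin by (simp add: linear_sum linear_scale)
  qed
  moreover have "smooth_on S (\<lambda>x. \<Sum>b\<in>Basis. (X x \<bullet> b) *\<^sub>R frechet_derivative f (at x) b)"
    by (intro smooth_on_sum smooth_on_scaleR smooth_on_bounded_linear[OF bounded_linear_inner_left]
        smooth_on_derivative assms)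
  ultimately show ?thesis by (subst smooth_on_cong[OF assms(3)]) auto
qed

lemma smooth_on_ident: "smooth_on S (\<lambda>x. x)"
  unfolding smooth_on_def
proof
  fix k show "Ck_on k S (\<lambda>x. x)" by (cases k) (auto simp: Ck_on_const)
qed

section \<open>Symmetry of second derivatives\<close>

lemma smooth_on_line_DERIV:
  assumes "smooth_on S f" "u + s *\<^sub>R v \<in> S"
  shows "DERIV (\<lambda>s. f (u + s *\<^sub>R v)) s :> frechet_derivative f (at (u + s *\<^sub>R v)) v"
proof -
  let ?D = "frechet_derivative f (at (u + s *\<^sub>R v))"
  have D: "(f has_derivative ?D) (at (u + s *\<^sub>R v))" using smooth_on_has_derivative assms .
  have "((\<lambda>s. u + s *\<^sub>R v) has_derivative (\<lambda>h. h *\<^sub>R v)) (at s)"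
    by (auto intro!: derivative_eq_intros)
  then have "((\<lambda>s. f (u + s *\<^sub>R v)) has_derivative (\<lambda>h. ?D (h *\<^sub>R v))) (at s)"
    using D by (rule has_derivative_compose)
  moreover have "(\<lambda>h. ?D (h *\<^sub>R v)) = (*) (?D v)"
    using linear_scale[OF has_derivative_linear[OF D]] by (auto simp: mult.commute)
  ultimately show ?thesis by (simp add: has_field_derivative_def)
qed

text \<open>The mean value theorem, used once in each of the two directions, turns a second difference
  quotient into a second derivative at an intermediate point.\<close>
lemma second_difference_mvt:
  fixes f :: "'v::real_normed_vector \<Rightarrow> real"
  assumes f: "smooth_on S f" and S: "ball x \<delta> \<subseteq> S" and h: "0 < h" "h * (norm v + norm w) < \<delta>"
  shows "\<exists>\<xi>\<in>ball x \<delta>. f (x + h *\<^sub>R v + h *\<^sub>R w) - f (x + h *\<^sub>R v) - f (x + h *\<^sub>R w) + f x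
    = h * h * frechet_derivative (\<lambda>y. frechet_derivative f (at y) v) (at \<xi>) w"
proof -
  have inb: "x + s *\<^sub>R v + t *\<^sub>R w \<in> ball x \<delta>" if "0 \<le> s" "s \<le> h" "0 \<le> t" "t \<le> h" for s t
  proof -
    have "norm (s *\<^sub>R v + t *\<^sub>R w) \<le> s * norm v + t * norm w"
      using norm_triangle_ineq[of "s *\<^sub>R v" "t *\<^sub>R w"] that by simp
    also have "\<dots> \<le> h * norm v + h * norm w"
      using that by (intro add_mono mult_right_mono) auto
    finally show ?thesis using h(2) by (simp add: dist_norm algebra_simps norm_minus_commute)
  qed
  let ?D = "\<lambda>y. frechet_derivative f (at y) v"
  let ?\<phi> = "\<lambda>s. f ((x + h *\<^sub>R w) + s *\<^sub>R v) - f (x + s *\<^sub>R v)"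
  have d: "DERIV ?\<phi> s :> ?D ((x + h *\<^sub>R w) + s *\<^sub>R v) - ?D (x + s *\<^sub>R v)" if "0 \<le> s" "s \<le> h" for s
    using inb[OF that, of h] inb[OF that, of 0] S h(1)
    by (intro DERIV_diff smooth_on_line_DERIV[OF f]) (auto simp: algebra_simps)
  obtain s where s: "0 < s" "s < h"
    and 1: "?\<phi> h - ?\<phi> 0 = (h - 0) * (?D ((x + h *\<^sub>R w) + s *\<^sub>R v) - ?D (x + s *\<^sub>R v))"
    using MVT2[OF h(1) d] by blast
  have d2: "DERIV (\<lambda>t. ?D ((x + s *\<^sub>R v) + t *\<^sub>R w)) t
      :> frechet_derivative ?D (at ((x + s *\<^sub>R v) + t *\<^sub>R w)) w"
    if "0 \<le> t" "t \<le> h" for t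
    using inb[of s t] s that S by (intro smooth_on_line_DERIV[OF smooth_on_derivative[OF f]]) auto
  obtain t where t: "0 < t" "t < h"
    and 2: "?D ((x + s *\<^sub>R v) + h *\<^sub>R w) - ?D ((x + s *\<^sub>R v) + 0 *\<^sub>R w)
        = (h - 0) * frechet_derivative ?D (at ((x + s *\<^sub>R v) + t *\<^sub>R w)) w"
    using MVT2[OF h(1) d2] by blast
  have "x + s *\<^sub>R v + t *\<^sub>R w \<in> ball x \<delta>" using inb s t by simp
  moreover have "f (x + h *\<^sub>R v + h *\<^sub>R w) - f (x + h *\<^sub>R v) - f (x + h *\<^sub>R w) + f x
    = h * h * frechet_derivative ?D (at (x + s *\<^sub>R v + t *\<^sub>R w)) w"
    using 1 2 by (simp add: add_ac mult.assoc)
  ultimately show ?thesis by blast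
qed

text \<open>The second difference quotient does not depend on the order of the two directions, and it
  tends to either of the two second derivatives.\<close>
lemma second_derivative_commute:
  fixes f :: "'v::real_normed_vector \<Rightarrow> real"
  assumes f: "smooth_on S f" and S: "open S" "x \<in> S"
  shows "frechet_derivative (\<lambda>y. frechet_derivative f (at y) v) (at x) w
       = frechet_derivative (\<lambda>y. frechet_derivative f (at y) w) (at x) v"
proof -
  define G where "G v w y = frechet_derivative (\<lambda>y. frechet_derivative f (at y) v) (at y) w" for v w y
  have cont: "isCont (G v w) x" for v w
  proof -
    have "smooth_on S (G v w)" unfolding G_def by (intro smooth_on_derivative f)
    then have "Ck_on 0 S (G v w)" unfolding smooth_on_def by blast
    then show ?thesis using S by (simp add: continuous_on_eq_continuous_at)
  qed
  have "\<bar>G v w x - G w v x\<bar> < e" if "e > 0" for e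
  proof -
    obtain d1 where d1: "d1 > 0" "\<And>y. dist y x < d1 \<Longrightarrow> \<bar>G v w y - G v w x\<bar> < e / 2"
      using cont[of v w] \<open>e > 0\<close> unfolding continuous_at dist_real_def
      by (metis half_gt_zero continuous_at_eps_delta cont dist_real_def)
    obtain d2 where d2: "d2 > 0" "\<And>y. dist y x < d2 \<Longrightarrow> \<bar>G w v y - G w v x\<bar> < e / 2"
      using cont[of w v] \<open>e > 0\<close> unfolding continuous_at dist_real_def
      by (metis half_gt_zero continuous_at_eps_delta cont dist_real_def)
    obtain d3 where d3: "d3 > 0" "ball x d3 \<subseteq> S" using S open_contains_ball by blast
    define \<delta> where "\<delta> = Min {d1, d2, d3}"
    have \<delta>: "\<delta> > 0" "\<delta> \<le> d1" "\<delta> \<le> d2" "\<delta> \<le> d3" unfolding \<delta>_def using d1 d2 d3 by auto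
    define h where "h = \<delta> / (norm v + norm w + 1)"
    have N: "norm v + norm w + 1 > 0" by (simp add: add_nonneg_pos)
    then have h: "h > 0" using \<delta> by (simp add: h_def)
    moreover have "h * (norm v + norm w) < \<delta>"
    proof -
      have "h * (norm v + norm w + 1) = \<delta>" using N by (simp add: h_def)
      then show ?thesis using h by (simp add: algebra_simps)
    qed
    moreover have "ball x \<delta> \<subseteq> S" using d3 \<delta> by (meson subset_ball order_trans)
    ultimately obtain \<xi> \<eta> where 1: "\<xi> \<in> ball x \<delta>" "\<eta> \<in> ball x \<delta>"
      "f (x + h *\<^sub>R v + h *\<^sub>R w) - f (x + h *\<^sub>R v) - f (x + h *\<^sub>R w) + f x = h * h * G v w \<xi>"
      "f (x + h *\<^sub>R w + h *\<^sub>R v) - f (x + h *\<^sub>R w) - f (x + h *\<^sub>R v) + f x = h * h * G w v \<eta>"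
      using second_difference_mvt[OF f, of x \<delta> h v w] second_difference_mvt[OF f, of x \<delta> h w v]
      unfolding G_def by (metis add.commute)
    have eq: "x + h *\<^sub>R w + h *\<^sub>R v = x + h *\<^sub>R v + h *\<^sub>R w" by (simp add: add_ac)
    have "h * h * G v w \<xi> = h * h * G w v \<eta>" using 1(3,4) unfolding eq by linarith
    then have "G v w \<xi> = G w v \<eta>" using h by simp
    moreover have "\<bar>G v w \<xi> - G v w x\<bar> < e / 2" "\<bar>G w v \<eta> - G w v x\<bar> < e / 2"
      using d1(2)[of \<xi>] d2(2)[of \<eta>] 1(1,2) \<delta> by (simp_all add: dist_commute)
    ultimately show ?thesis by linarith
  qed
  then have "G v w x = G w v x" by (metis abs_le_zero_iff eq_iff_diff_eq_0 less_irrefl not_le)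
  then show ?thesis by (simp add: G_def)
qed

text \<open>Linearity in the direction of the inner derivative is not immediate, as that direction sits under
  the outer derivative; by symmetry it may be moved outside.\<close>
lemma second_derivative_linear:
  fixes h :: "'v::euclidean_space \<Rightarrow> real"
  assumes h: "smooth_on S h" and S: "open S" "u \<in> S"
  shows "frechet_derivative (\<lambda>y. frechet_derivative h (at y) v) (at u) w
    = (\<Sum>b\<in>Basis. (v \<bullet> b) * frechet_derivative (\<lambda>y. frechet_derivative h (at y) b) (at u) w)"
proof -
  have "frechet_derivative (\<lambda>y. frechet_derivative h (at y) v) (at u) w
      = frechet_derivative (\<lambda>y. frechet_derivative h (at y) w) (at u) v"
    using h S by (rule second_derivative_commute)
  also have "\<dots> = frechet_derivative (\<lambda>y. frechet_derivative h (at y) w) (at u) (\<Sum>b\<in>Basis. (v \<bullet> b) *\<^sub>R b)"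
    by (simp add: euclidean_representation)
  also have "\<dots> = (\<Sum>b\<in>Basis. (v \<bullet> b) * frechet_derivative (\<lambda>y. frechet_derivative h (at y) w) (at u) b)"
    using linear_frechet_derivative[OF smooth_on_imp_differentiable[OF smooth_on_derivative[OF h] S(2), of w]]
    by (simp add: linear_sum linear_scale)
  also have "\<dots> = (\<Sum>b\<in>Basis. (v \<bullet> b) * frechet_derivative (\<lambda>y. frechet_derivative h (at y) b) (at u) w)"
    by (simp add: second_derivative_commute[OF h S])
  finally show ?thesis .
qed

text \<open>In coordinates this is the derivative of \<open>Y f\<close>: one term with the second derivative of \<open>f\<close>, which
  cancels in a commutator, and one with the derivative of \<open>Y\<close>, which makes up the bracket.\<close>
lemma has_derivative_derivative_along:
  fixes h :: "'v::euclidean_space \<Rightarrow> real"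
  assumes h: "smooth_on S h" and \<eta>: "smooth_on S \<eta>" and S: "open S" "u \<in> S"
  shows "((\<lambda>y. frechet_derivative h (at y) (\<eta> y)) has_derivative
    (\<lambda>w. frechet_derivative h (at u) (frechet_derivative \<eta> (at u) w)
       + frechet_derivative (\<lambda>y. frechet_derivative h (at y) (\<eta> u)) (at u) w)) (at u)"
proof -
  have expand: "frechet_derivative h (at y) v = (\<Sum>b\<in>Basis. (v \<bullet> b) * frechet_derivative h (at y) b)"
    if "y \<in> S" for y v
  proof -
    have "frechet_derivative h (at y) v = frechet_derivative h (at y) (\<Sum>b\<in>Basis. (v \<bullet> b) *\<^sub>R b)"
      by (simp add: euclidean_representation)
    then show ?thesis
      using linear_frechet_derivative[OF smooth_on_imp_differentiable[OF h that]]
      by (simp add: linear_sum linear_scale)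
  qed
  have b: "((\<lambda>y. (\<eta> y \<bullet> b) * frechet_derivative h (at y) b) has_derivative
     (\<lambda>w. (\<eta> u \<bullet> b) * frechet_derivative (\<lambda>y. frechet_derivative h (at y) b) (at u) w
        + (frechet_derivative \<eta> (at u) w \<bullet> b) * frechet_derivative h (at u) b)) (at u)" for b
    by (intro has_derivative_mult has_derivative_inner_left smooth_on_has_derivative[OF \<eta> S(2)]
        smooth_on_has_derivative[OF smooth_on_derivative[OF h] S(2)])
  have "((\<lambda>y. \<Sum>b\<in>Basis. (\<eta> y \<bullet> b) * frechet_derivative h (at y) b) has_derivative
    (\<lambda>w. frechet_derivative h (at u) (frechet_derivative \<eta> (at u) w)
       + frechet_derivative (\<lambda>y. frechet_derivative h (at y) (\<eta> u)) (at u) w)) (at u)"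
    using has_derivative_sum[where I = Basis, OF b]
    by (simp add: expand[OF S(2), of "frechet_derivative \<eta> (at u) _"]
        second_derivative_linear[OF h S, of "\<eta> u"] sum.distrib add.commute)
  then show ?thesis
    by (rule has_derivative_transform_within_open[OF _ S]) (simp add: expand[of _ "\<eta> _"])
qed

section \<open>Bump functions\<close>

text \<open>For \<open>k = 0\<close> this is the classical flat function. With the powers of \<open>t\<close> in the denominator the
  linear span of the family is closed under differentiation, so that all orders of
  differentiability follow by one induction.\<close>
definition flat_fun :: "nat \<Rightarrow> real \<Rightarrow> real" where
  "flat_fun k t = (if t \<le> 0 then 0 else exp (- (1 / t)) / t ^ k)"

lemma flat_fun_tendsto_0: "((\<lambda>t. exp (- (1 / t)) / t ^ k) \<longlongrightarrow> (0::real)) (at_right 0)"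
proof -
  have "((\<lambda>x. x ^ k / exp x) \<longlongrightarrow> (0::real)) at_top" by (rule tendsto_power_div_exp_0)
  then have "((\<lambda>t. inverse t ^ k / exp (inverse t)) \<longlongrightarrow> (0::real)) (at_right 0)"
    by (rule filterlim_compose[OF _ filterlim_inverse_at_top_right])
  then show ?thesis by (simp add: exp_minus field_simps inverse_eq_divide power_one_over)
qed

lemma flat_fun_DERIV:
  "DERIV (flat_fun k) t :> flat_fun (k + 2) t - real k * flat_fun (k + 1) t"
proof (cases t "0::real" rule: linorder_cases)
  case less
  have "DERIV (\<lambda>t. 0) t :> flat_fun (k + 2) t - real k * flat_fun (k + 1) t"
    using less by (simp add: flat_fun_def)
  then show ?thesis
    by (rule has_field_derivative_transform_within_open[of _ _ _ "{..<0}"]) (use less in \<open>auto simp: flat_fun_def\<close>)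
next
  case greater
  have "DERIV (\<lambda>t. exp (- (1 / t)) / t ^ k) t
    :> (exp (- (1 / t)) * (1 / t\<^sup>2) * t ^ k - exp (- (1 / t)) * (real k * t ^ (k - Suc 0))) / (t ^ k * t ^ k)"
    using greater by (auto intro!: derivative_eq_intros simp: power2_eq_square)
  moreover have "(exp (- (1 / t)) * (1 / t\<^sup>2) * t ^ k - exp (- (1 / t)) * (real k * t ^ (k - Suc 0))) / (t ^ k * t ^ k)
    = flat_fun (k + 2) t - real k * flat_fun (k + 1) t"
  proof -
    have p: "real k * t ^ (k - Suc 0) = real k * t ^ k / t"
      using greater by (cases k) auto
    have "(E * (1 / t\<^sup>2) * T - E * (real k * T / t)) / (T * T) = E / (T * t\<^sup>2) - real k * (E / (T * t))"
      if "T > 0" for E T :: real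
      using greater that by (simp add: field_simps power2_eq_square)
    from this[of "t ^ k" "exp (- (1 / t))"] show ?thesis
      unfolding p using greater by (simp add: flat_fun_def power_add power2_eq_square mult_ac)
  qed
  ultimately have "DERIV (\<lambda>t. exp (- (1 / t)) / t ^ k) t :> flat_fun (k + 2) t - real k * flat_fun (k + 1) t"
    by simp
  then show ?thesis
    by (rule has_field_derivative_transform_within_open[of _ _ _ "{0<..}"]) (use greater in \<open>auto simp: flat_fun_def\<close>)
next
  case equal
  \<comment> \<open>From the right, the difference quotient at \<open>0\<close> is the function with index \<open>k + 1\<close>.\<close>
  have "((\<lambda>h. (flat_fun k (0 + h) - flat_fun k 0) / h) \<longlongrightarrow> 0) (at 0)"
    unfolding filterlim_at_split
  proof
    show "((\<lambda>h. (flat_fun k (0 + h) - flat_fun k 0) / h) \<longlongrightarrow> 0) (at_left 0)"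
      by (rule tendsto_eventually) (auto simp: eventually_at_filter flat_fun_def)
    have "\<forall>\<^sub>F h in at_right 0. exp (- (1 / h)) / h ^ Suc k = (flat_fun k (0 + h) - flat_fun k 0) / h"
      by (auto simp: eventually_at_filter flat_fun_def)
    then show "((\<lambda>h. (flat_fun k (0 + h) - flat_fun k 0) / h) \<longlongrightarrow> 0) (at_right 0)"
      using flat_fun_tendsto_0[of "Suc k"] by (rule Lim_transform_eventually[rotated])
  qed
  then show ?thesis using equal by (simp add: DERIV_def flat_fun_def)
qed

lemma flat_fun_smooth: "smooth_on UNIV (flat_fun k)"
  unfolding smooth_on_def
proof
  fix r show "Ck_on r UNIV (flat_fun k)"
  proof (induction r arbitrary: k)
    case 0
    show ?case using DERIV_isCont[OF flat_fun_DERIV] by (simp add: continuous_at_imp_continuous_on)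
  next
    case (Suc r)
    have d: "(flat_fun k has_derivative (\<lambda>h. (flat_fun (k + 2) t - real k * flat_fun (k + 1) t) * h)) (at t)" for t
      using flat_fun_DERIV[of k t] by (simp add: has_field_derivative_def)
    have "Ck_on r UNIV (\<lambda>t. frechet_derivative (flat_fun k) (at t) v)" for v
    proof -
      have "frechet_derivative (flat_fun k) (at t) v
        = flat_fun (k + 2) t * v + (- real k * v) * flat_fun (k + 1) t" for t
        using fun_cong[OF frechet_derivative_at[OF d[of t]], of v] by (simp add: algebra_simps)
      then show ?thesis
        by (simp only:) (intro Ck_on_add Ck_on_bilinear[OF bounded_bilinear_mult] Ck_on_const Suc.IH open_UNIV)
    qed
    then show ?case using d by (auto simp: differentiable_def)
  qed
qed

lemma bump_function_exists:
  fixes u :: "'v::euclidean_space"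
  assumes "r > 0"
  obtains \<phi> :: "'v \<Rightarrow> real" where "smooth_on UNIV \<phi>" "\<phi> u \<noteq> 0" "\<And>x. x \<notin> cball u r \<Longrightarrow> \<phi> x = 0"
proof
  let ?\<phi> = "\<lambda>x. flat_fun 0 (r\<^sup>2 + (- 1) * ((x + (- u)) \<bullet> (x + (- u))))"
  show "smooth_on UNIV ?\<phi>"
    by (intro smooth_on_compose[OF flat_fun_smooth] smooth_on_add smooth_on_mult
        smooth_on_bilinear[OF bounded_bilinear_inner] smooth_on_const smooth_on_ident) auto
  show "?\<phi> u \<noteq> 0" using assms by (auto simp: flat_fun_def)
  fix x assume "x \<notin> cball u r"
  then have "r < norm (x - u)" by (simp add: dist_norm norm_minus_commute)
  then have "r\<^sup>2 < (norm (x - u))\<^sup>2" using assms by (intro power_strict_mono) auto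
  then show "?\<phi> x = 0" by (simp add: flat_fun_def power2_norm_eq_inner)
qed

section \<open>Functions and vector fields on a manifold\<close>

locale smooth_manifold =
  fixes A :: "('a::{t2_space,second_countable_topology}, 'm::finite) chart set"
  assumes atlas: "smooth_atlas A"
begin

abbreviation transition :: "('a, 'm) chart \<Rightarrow> ('a, 'm) chart \<Rightarrow> real^'m \<Rightarrow> real^'m" where
  "transition c d \<equiv> snd d \<circ> chart_inv c"

abbreviation overlap :: "('a, 'm) chart \<Rightarrow> ('a, 'm) chart \<Rightarrow> (real^'m) set" where
  "overlap c d \<equiv> snd c ` (fst c \<inter> fst d)"

lemma chart_homeomorphism:
  "c \<in> A \<Longrightarrow> homeomorphism (fst c) (chart_image c) (snd c) (chart_inv c)"
  using atlas by (simp add: smooth_atlas_def)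

lemma open_chart_domain: "c \<in> A \<Longrightarrow> open (fst c)"
  and open_chart_image: "c \<in> A \<Longrightarrow> open (chart_image c)"
  using atlas by (simp_all add: smooth_atlas_def)

lemma chart_inv_chart [simp]: "c \<in> A \<Longrightarrow> q \<in> fst c \<Longrightarrow> chart_inv c (snd c q) = q"
  using chart_homeomorphism[of c] by (simp add: homeomorphism_def)

lemma chart_chart_inv [simp]: "u \<in> chart_image c \<Longrightarrow> snd c (chart_inv c u) = u"
  by (rule f_inv_into_f)

lemma chart_inv_in_domain: "u \<in> chart_image c \<Longrightarrow> chart_inv c u \<in> fst c"
  by (rule inv_into_into)

lemma chart_at: "chart_at A q \<in> A" "q \<in> fst (chart_at A q)"
proof -
  have "q \<in> (\<Union>c\<in>A. fst c)" using atlas by (simp add: smooth_atlas_def)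
  then have "\<exists>c. c \<in> A \<and> q \<in> fst c" by blast
  then have "chart_at A q \<in> A \<and> q \<in> fst (chart_at A q)"
    unfolding chart_at_def by (rule someI_ex)
  then show "chart_at A q \<in> A" "q \<in> fst (chart_at A q)" by auto
qed

lemma open_chart_subset:
  assumes "c \<in> A" "open U"
  shows "open (snd c ` (fst c \<inter> U))"
proof -
  have "snd c ` (fst c \<inter> U) = chart_image c \<inter> chart_inv c -` U"
    using assms(1) by (auto simp: chart_inv_in_domain rev_image_eqI)
  moreover have "continuous_on (chart_image c) (chart_inv c)"
    using chart_homeomorphism[OF assms(1)] by (simp add: homeomorphism_def)
  ultimately show ?thesis
    using continuous_open_preimage[OF _ open_chart_image[OF assms(1)] assms(2)] by simp
qed

lemma open_overlap: "c \<in> A \<Longrightarrow> d \<in> A \<Longrightarrow> open (overlap c d)"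
  by (intro open_chart_subset open_chart_domain)

lemma transition_smooth: "c \<in> A \<Longrightarrow> d \<in> A \<Longrightarrow> smooth_on (overlap c d) (transition c d)"
  using atlas by (simp add: smooth_atlas_def)

lemma transition_has_derivative:
  "c \<in> A \<Longrightarrow> d \<in> A \<Longrightarrow> q \<in> fst c \<Longrightarrow> q \<in> fst d \<Longrightarrow>
    (transition c d has_derivative frechet_derivative (transition c d) (at (snd c q))) (at (snd c q))"
  by (rule smooth_on_has_derivative[OF transition_smooth]) auto

text \<open>The chain rule in the form in which all changes of charts use it: \<open>h\<close> may be a function on the
  manifold or another coordinate map.\<close>
lemma change_of_chart_has_derivative:
  assumes cd: "c \<in> A" "d \<in> A" "q \<in> fst c" "q \<in> fst d"
    and h: "(h \<circ> chart_inv d) differentiable (at (snd d q))"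
  shows "((h \<circ> chart_inv c) has_derivative (\<lambda>v. frechet_derivative (h \<circ> chart_inv d) (at (snd d q))
     (frechet_derivative (transition c d) (at (snd c q)) v))) (at (snd c q))"
proof -
  have "transition c d (snd c q) = snd d q" using cd by simp
  then have "((h \<circ> chart_inv d) has_derivative frechet_derivative (h \<circ> chart_inv d) (at (snd d q)))
      (at (transition c d (snd c q)))"
    using h by (simp add: frechet_derivative_works)
  from has_derivative_compose[OF transition_has_derivative[OF cd] this]
  show ?thesis
  proof (rule has_derivative_transform_within_open)
    show "open (overlap c d)" using cd by (intro open_overlap)
  qed (use cd in \<open>auto simp: o_def\<close>)
qed

lemma transition_cocycle:
  assumes "c \<in> A" "d \<in> A" "e \<in> A" "q \<in> fst c" "q \<in> fst d" "q \<in> fst e"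
  shows "frechet_derivative (transition c e) (at (snd c q)) v
    = frechet_derivative (transition d e) (at (snd d q)) (frechet_derivative (transition c d) (at (snd c q)) v)"
proof -
  have "transition d e differentiable at (snd d q)"
    using transition_has_derivative[of d e q] assms differentiableI by blast
  from fun_cong[OF frechet_derivative_at[OF
      change_of_chart_has_derivative[OF assms(1,2,4,5) this]], of v]
  show ?thesis by simp
qed

lemma transition_self:
  assumes "c \<in> A" "q \<in> fst c"
  shows "frechet_derivative (transition c c) (at (snd c q)) v = v"
proof -
  have "((\<lambda>x. x) has_derivative (\<lambda>v. v)) (at (snd c q))" by (rule has_derivative_ident)
  then have "(transition c c has_derivative (\<lambda>v. v)) (at (snd c q))"
    by (rule has_derivative_transform_within_open[OF _ open_chart_image[OF assms(1)]]) (use assms in auto)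
  from fun_cong[OF frechet_derivative_at[OF this], of v] show ?thesis by simp
qed

lemma components_linear: "c \<in> A \<Longrightarrow> q \<in> fst c \<Longrightarrow> linear (components A c q)"
  unfolding components_def
  using has_derivative_linear[OF transition_has_derivative[of "chart_at A q" c q]] chart_at[of q]
  by simp

lemma components_chart_at [simp]: "components A (chart_at A q) q v = v"
  unfolding components_def using transition_self chart_at by simp

lemma coord_field_chart: "c \<in> A \<Longrightarrow> q \<in> fst c \<Longrightarrow> coord_field A c X (snd c q) = components A c q (X q)"
  by (simp add: coord_field_def)

lemma smooth_fun_chart: "smooth_fun A f \<Longrightarrow> c \<in> A \<Longrightarrow> smooth_on (chart_image c) (f \<circ> chart_inv c)"
  by (simp add: smooth_fun_def)

lemma smooth_field_chart: "smooth_field A X \<Longrightarrow> c \<in> A \<Longrightarrow> smooth_on (chart_image c) (coord_field A c X)"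
  by (simp add: smooth_field_def)

lemma dir_deriv_chart:
  assumes "smooth_fun A f" "c \<in> A" "q \<in> fst c"
  shows "dir_deriv A X f q = frechet_derivative (f \<circ> chart_inv c) (at (snd c q)) (components A c q (X q))"
proof -
  have "(f \<circ> chart_inv c) differentiable (at (snd c q))"
    using smooth_fun_chart[OF assms(1,2)] assms(3) by (auto intro: smooth_on_imp_differentiable)
  from fun_cong[OF frechet_derivative_at[OF
      change_of_chart_has_derivative[OF chart_at(1) assms(2) chart_at(2) assms(3) this]], of "X q"]
  show ?thesis by (simp add: dir_deriv_def components_def)
qed

lemma smooth_fun_const: "smooth_fun A (\<lambda>q. k)"
  by (simp add: smooth_fun_def o_def smooth_on_const)

lemma smooth_fun_add: "smooth_fun A f \<Longrightarrow> smooth_fun A h \<Longrightarrow> smooth_fun A (\<lambda>q. f q + h q)"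
  by (simp add: smooth_fun_def o_def smooth_on_add open_chart_image)

lemma smooth_fun_mult: "smooth_fun A f \<Longrightarrow> smooth_fun A h \<Longrightarrow> smooth_fun A (\<lambda>q. f q * h q)"
  by (simp add: smooth_fun_def o_def smooth_on_mult open_chart_image)

lemma smooth_fun_diff: "smooth_fun A f \<Longrightarrow> smooth_fun A h \<Longrightarrow> smooth_fun A (\<lambda>q. f q - h q)"
  using smooth_fun_add[of f "\<lambda>q. (- 1) * h q"] smooth_fun_mult[OF smooth_fun_const, of h "- 1"] by simp

lemma smooth_field_add:
  assumes "smooth_field A X" "smooth_field A Y"
  shows "smooth_field A (\<lambda>q. X q + Y q)"
  unfolding smooth_field_def
proof
  fix c assume c: "c \<in> A"
  have "smooth_on (chart_image c) (\<lambda>u. coord_field A c X u + coord_field A c Y u)"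
    using assms c by (intro smooth_on_add smooth_field_chart open_chart_image)
  then show "smooth_on (chart_image c) (coord_field A c (\<lambda>q. X q + Y q))"
    by (subst smooth_on_cong[OF open_chart_image[OF c]])
      (use c in \<open>auto simp: coord_field_chart linear_add components_linear\<close>)
qed

lemma smooth_field_scaleR:
  assumes "smooth_fun A f" "smooth_field A X"
  shows "smooth_field A (\<lambda>q. f q *\<^sub>R X q)"
  unfolding smooth_field_def
proof
  fix c assume c: "c \<in> A"
  have "smooth_on (chart_image c) (\<lambda>u. (f \<circ> chart_inv c) u *\<^sub>R coord_field A c X u)"
    using assms c by (intro smooth_on_scaleR smooth_field_chart smooth_fun_chart open_chart_image)
  then show "smooth_on (chart_image c) (coord_field A c (\<lambda>q. f q *\<^sub>R X q))"
    by (subst smooth_on_cong[OF open_chart_image[OF c]])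
      (use c in \<open>auto simp: coord_field_chart linear_scale components_linear\<close>)
qed

lemma smooth_field_scale_const: "smooth_field A X \<Longrightarrow> smooth_field A (\<lambda>q. k *\<^sub>R X q)"
  by (rule smooth_field_scaleR[OF smooth_fun_const])

lemma smooth_field_minus: "smooth_field A X \<Longrightarrow> smooth_field A (\<lambda>q. - X q)"
  using smooth_field_scale_const[of X "- 1"] by simp

lemma smooth_field_diff:
  "smooth_field A X \<Longrightarrow> smooth_field A Y \<Longrightarrow> smooth_field A (\<lambda>q. X q - Y q)"
  using smooth_field_add[of X "\<lambda>q. - Y q"] smooth_field_minus[of Y] by simp

lemma smooth_fun_dir_deriv:
  assumes "smooth_fun A f" "smooth_field A X"
  shows "smooth_fun A (dir_deriv A X f)"
  unfolding smooth_fun_def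
proof
  fix c assume c: "c \<in> A"
  have "smooth_on (chart_image c) (\<lambda>u. frechet_derivative (f \<circ> chart_inv c) (at u) (coord_field A c X u))"
    using assms c by (intro smooth_on_derivative_along smooth_field_chart smooth_fun_chart open_chart_image)
  then show "smooth_on (chart_image c) (dir_deriv A X f \<circ> chart_inv c)"
    by (subst smooth_on_cong[OF open_chart_image[OF c]])
      (use c assms(1) in \<open>auto simp: coord_field_chart dir_deriv_chart\<close>)
qed

lemma fun_has_derivative:
  "smooth_fun A f \<Longrightarrow> c \<in> A \<Longrightarrow> q \<in> fst c \<Longrightarrow>
    ((f \<circ> chart_inv c) has_derivative frechet_derivative (f \<circ> chart_inv c) (at (snd c q))) (at (snd c q))"
  by (rule smooth_on_has_derivative[OF smooth_fun_chart]) auto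

lemma dir_deriv_add:
  assumes "smooth_fun A f" "smooth_fun A h"
  shows "dir_deriv A X (\<lambda>q. f q + h q) q = dir_deriv A X f q + dir_deriv A X h q"
  using fun_cong[OF frechet_derivative_at[OF has_derivative_add[OF
      fun_has_derivative[OF assms(1) chart_at, of q] fun_has_derivative[OF assms(2) chart_at, of q]]], of "X q"]
  by (simp add: dir_deriv_def o_def)

lemma dir_deriv_mult:
  assumes "smooth_fun A f" "smooth_fun A h"
  shows "dir_deriv A X (\<lambda>q. f q * h q) q = f q * dir_deriv A X h q + dir_deriv A X f q * h q"
  using fun_cong[OF frechet_derivative_at[OF has_derivative_mult[OF
      fun_has_derivative[OF assms(1) chart_at, of q] fun_has_derivative[OF assms(2) chart_at, of q]]], of "X q"]
  by (simp add: dir_deriv_def o_def chart_at)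

lemma dir_deriv_const: "dir_deriv A X (\<lambda>q. k) q = 0"
  by (simp add: dir_deriv_def o_def)

lemma dir_deriv_scale:
  "smooth_fun A f \<Longrightarrow> dir_deriv A X (\<lambda>q. k * f q) q = k * dir_deriv A X f q"
  using dir_deriv_mult[OF smooth_fun_const] by (simp add: dir_deriv_const)

lemma dir_deriv_diff:
  assumes "smooth_fun A f" "smooth_fun A h"
  shows "dir_deriv A X (\<lambda>q. f q - h q) q = dir_deriv A X f q - dir_deriv A X h q"
  using dir_deriv_add[OF assms(1) smooth_fun_mult[OF smooth_fun_const assms(2)], of X "- 1" q]
    dir_deriv_scale[OF assms(2), of X "- 1" q] by simp

lemma dir_deriv_field_add:
  assumes "smooth_fun A f"
  shows "dir_deriv A (\<lambda>q. X q + Y q) f q = dir_deriv A X f q + dir_deriv A Y f q"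
  using has_derivative_linear[OF fun_has_derivative[OF assms chart_at], of q]
  unfolding dir_deriv_def by (rule linear_add)

lemma dir_deriv_field_scaleR:
  assumes "smooth_fun A f"
  shows "dir_deriv A (\<lambda>q. k q *\<^sub>R X q) f q = k q * dir_deriv A X f q"
  using linear_scale[OF has_derivative_linear[OF fun_has_derivative[OF assms chart_at], of q]]
  unfolding dir_deriv_def by simp

lemma dir_deriv_field_diff:
  assumes "smooth_fun A f"
  shows "dir_deriv A (\<lambda>q. X q - Y q) f q = dir_deriv A X f q - dir_deriv A Y f q"
  using linear_diff[OF has_derivative_linear[OF fun_has_derivative[OF assms chart_at], of q]]
  unfolding dir_deriv_def by blast

text \<open>The iterated derivative at \<open>q\<close> involves \<open>dir_deriv\<close> at all nearby points, each of them computed in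
  its own chart. By \<open>dir_deriv_chart\<close> all of them may be computed in the chart chosen at \<open>q\<close>;
  the second derivatives of the function then cancel by symmetry.\<close>
lemma dir_deriv_lie_bracket:
  assumes f: "smooth_fun A f" and X: "smooth_field A X" and Y: "smooth_field A Y"
  shows "dir_deriv A (lie_bracket A X Y) f q
    = dir_deriv A X (dir_deriv A Y f) q - dir_deriv A Y (dir_deriv A X f) q"
proof -
  let ?c = "chart_at A q"
  let ?u = "snd ?c q" and ?h = "f \<circ> chart_inv ?c" and ?S = "chart_image ?c"
  have c: "?c \<in> A" "q \<in> fst ?c" by (rule chart_at)+
  have S: "open ?S" "?u \<in> ?S" using c open_chart_image by auto
  have h: "smooth_on ?S ?h" using f c by (intro smooth_fun_chart)
  have iter: "dir_deriv A V (dir_deriv A W f) q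
      = frechet_derivative ?h (at ?u) (frechet_derivative (coord_field A ?c W) (at ?u) (V q))
        + frechet_derivative (\<lambda>y. frechet_derivative ?h (at y) (W q)) (at ?u) (V q)"
    if W: "smooth_field A W" for V W
  proof -
    have "coord_field A ?c W ?u = W q" using c by (simp add: coord_field_chart)
    then have "((\<lambda>y. frechet_derivative ?h (at y) (coord_field A ?c W y)) has_derivative
        (\<lambda>v. frechet_derivative ?h (at ?u) (frechet_derivative (coord_field A ?c W) (at ?u) v)
           + frechet_derivative (\<lambda>y. frechet_derivative ?h (at y) (W q)) (at ?u) v)) (at ?u)"
      using has_derivative_derivative_along[OF h smooth_field_chart[OF W c(1)] S] by simp
    then have "((dir_deriv A W f \<circ> chart_inv ?c) has_derivative
        (\<lambda>v. frechet_derivative ?h (at ?u) (frechet_derivative (coord_field A ?c W) (at ?u) v)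
           + frechet_derivative (\<lambda>y. frechet_derivative ?h (at y) (W q)) (at ?u) v)) (at ?u)"
      by (rule has_derivative_transform_within_open[OF _ S])
        (use f c in \<open>auto simp: dir_deriv_chart coord_field_chart\<close>)
    from fun_cong[OF frechet_derivative_at[OF this], of "V q"] show ?thesis
      by (simp add: dir_deriv_def[of A V "dir_deriv A W f"])
  qed
  show ?thesis
    unfolding iter[OF X] iter[OF Y] second_derivative_commute[OF h S, of "X q" "Y q"]
    using linear_diff[OF has_derivative_linear[OF smooth_on_has_derivative[OF h S(2)]]]
    by (simp add: dir_deriv_def lie_bracket_def Let_def)
qed

section \<open>Extension of local data to the manifold\<close>

text \<open>Data given in a chart and cut off outside a compact subset of its domain extend by zero to
  the whole manifold: in another chart the extension is smooth on the overlap and vanishes on the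
  complement of the compact set, and these two open sets cover the image of the chart.\<close>
lemma smooth_extension_by_zero:
  assumes c: "c \<in> A" "cball u r \<subseteq> chart_image c" and d: "d \<in> A"
    and F: "smooth_on (overlap d c) F"
    and 0: "\<And>q. q \<in> fst d \<Longrightarrow> q \<notin> fst c \<or> snd c q \<notin> cball u r \<Longrightarrow> F (snd d q) = 0"
  shows "smooth_on (chart_image d) F"
proof -
  let ?K = "chart_inv c ` cball u r"
  have "continuous_on (cball u r) (chart_inv c)"
    using chart_homeomorphism[OF c(1)] c(2) by (auto simp: homeomorphism_def intro: continuous_on_subset)
  then have K: "closed ?K" by (intro compact_imp_closed compact_continuous_image) auto
  have out: "q \<notin> fst c \<or> snd c q \<notin> cball u r" if "q \<notin> ?K" for q
    using that imageI[of "snd c q" "cball u r" "chart_inv c"] chart_inv_chart[OF c(1)] by metis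
  have KU: "?K \<subseteq> fst c" by (intro image_subsetI chart_inv_in_domain) (use c(2) in blast)
  let ?V = "snd d ` (fst d \<inter> - ?K)"
  have V: "open ?V" using K by (intro open_chart_subset d) auto
  have "smooth_on ?V F"
    using 0 out by (subst smooth_on_cong[OF V, of F "\<lambda>_. 0"]) (auto simp: smooth_on_const)
  then have "smooth_on (overlap d c \<union> ?V) F" using F V c d by (intro smooth_on_Un open_overlap)
  moreover have "overlap d c \<union> ?V = chart_image d" using KU by blast
  ultimately show ?thesis by simp
qed

lemma chart_bump_function:
  assumes "u = snd (chart_at A p) p"
  shows "\<exists>r \<phi>. cball u r \<subseteq> chart_image (chart_at A p) \<and> smooth_on UNIV \<phi> \<and> \<phi> u \<noteq> (0::real) \<and>
    (\<forall>x. x \<notin> cball u r \<longrightarrow> \<phi> x = 0)"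
proof -
  have "u \<in> chart_image (chart_at A p)" "open (chart_image (chart_at A p))"
    using assms chart_at open_chart_image by auto
  then obtain r where r: "r > 0" "cball u r \<subseteq> chart_image (chart_at A p)"
    using open_contains_cball by blast
  obtain \<phi> :: "real^'m \<Rightarrow> real" where "smooth_on UNIV \<phi>" "\<phi> u \<noteq> 0" "\<And>x. x \<notin> cball u r \<Longrightarrow> \<phi> x = 0"
    using bump_function_exists[OF r(1), of u] by blast
  with r(2) show ?thesis by blast
qed

text \<open>The constant coordinate field \<open>v\<close>, multiplied by a bump function, extends by zero. The factor \<open>k\<close>
  is the value of the bump function at its centre.\<close>
lemma smooth_field_through:
  obtains X k where "smooth_field A X" "k \<noteq> 0" "X p = k *\<^sub>R v"
proof -
  define u where u: "u = snd (chart_at A p) p"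
  obtain r \<phi> where b: "u = snd (chart_at A p) p" "cball u r \<subseteq> chart_image (chart_at A p)"
    "smooth_on UNIV \<phi>" "\<phi> u \<noteq> (0::real)" "\<And>x. x \<notin> cball u r \<Longrightarrow> \<phi> x = 0"
    using chart_bump_function[OF u] u by blast
  define c where "c = chart_at A p"
  have c: "c \<in> A" "p \<in> fst c" unfolding c_def by (rule chart_at)+
  define X where "X q = (if q \<in> fst c then
    \<phi> (snd c q) *\<^sub>R frechet_derivative (transition c (chart_at A q)) (at (snd c q)) v else 0)" for q
  have "X p = \<phi> u *\<^sub>R v" using c transition_self[OF c] by (simp add: X_def b(1) c_def)
  moreover have "smooth_field A X" unfolding smooth_field_def
  proof
    fix d assume d: "d \<in> A"
    have X: "components A d q (X q) = \<phi> (snd c q) *\<^sub>R frechet_derivative (transition c d) (at (snd c q)) v"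
      if q: "q \<in> fst d" "q \<in> fst c" for q
      unfolding X_def
      using transition_cocycle[OF c(1) chart_at(1) d q(2) chart_at(2) q(1), of v] q
        linear_scale[OF components_linear[OF d q(1)]]
      by (simp add: components_def)
    show "smooth_on (chart_image d) (coord_field A d X)"
    proof (rule smooth_extension_by_zero[OF c(1) b(2)[folded c_def] d])
      have sub: "transition d c ` overlap d c \<subseteq> overlap c d" using c d by auto
      have "smooth_on (overlap d c) (\<lambda>y. \<phi> (transition d c y) *\<^sub>R
          frechet_derivative (transition c d) (at (transition d c y)) v)"
        using c d sub
        by (intro smooth_on_scaleR open_overlap smooth_on_compose[OF b(3)] transition_smooth
            smooth_on_compose[OF smooth_on_derivative[OF transition_smooth[of c d]]]) auto
      then show "smooth_on (overlap d c) (coord_field A d X)"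
        by (subst smooth_on_cong[OF open_overlap[OF d c(1)]]) (use c d in \<open>auto simp: coord_field_chart X\<close>)
      fix q assume q: "q \<in> fst d" "q \<notin> fst c \<or> snd c q \<notin> cball u r"
      then have "X q = 0" by (auto simp: X_def b(5))
      then show "coord_field A d X (snd d q) = 0"
        using q d linear_0[OF components_linear] by (simp add: coord_field_chart)
    qed
  qed
  ultimately show thesis using that b(4) by blast
qed

text \<open>The test function is the cut-off of the affine coordinate function whose gradient is the vector
  itself; its derivative along the vector is a nonzero multiple of the squared length.\<close>
lemma smooth_functions_separate_vectors:
  assumes "\<And>f. smooth_fun A f \<Longrightarrow> dir_deriv A X f p = 0"
  shows "X p = 0"
proof -
  define u where u: "u = snd (chart_at A p) p"
  obtain r \<phi> where b: "u = snd (chart_at A p) p" "cball u r \<subseteq> chart_image (chart_at A p)"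
    "smooth_on UNIV \<phi>" "\<phi> u \<noteq> (0::real)" "\<And>x. x \<notin> cball u r \<Longrightarrow> \<phi> x = 0"
    using chart_bump_function[OF u] u by blast
  define c where "c = chart_at A p"
  have c: "c \<in> A" "p \<in> fst c" unfolding c_def by (rule chart_at)+
  define h where "h y = \<phi> y * ((y + (- u)) \<bullet> X p)" for y
  define f where "f q = (if q \<in> fst c then h (snd c q) else 0)" for q
  have h: "smooth_on UNIV h"
    unfolding h_def
    by (intro smooth_on_mult b smooth_on_bounded_linear[OF bounded_linear_inner_left]
        smooth_on_add smooth_on_const smooth_on_ident) auto
  have "smooth_fun A f" unfolding smooth_fun_def
  proof
    fix d assume d: "d \<in> A"
    show "smooth_on (chart_image d) (f \<circ> chart_inv d)"
    proof (rule smooth_extension_by_zero[OF c(1) b(2)[folded c_def] d])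
      have "smooth_on (overlap d c) (\<lambda>y. h (transition d c y))"
        using c d by (intro smooth_on_compose[OF h] transition_smooth open_overlap) auto
      then show "smooth_on (overlap d c) (f \<circ> chart_inv d)"
        by (subst smooth_on_cong[OF open_overlap[OF d c(1)]]) (use c d in \<open>auto simp: f_def\<close>)
      fix q assume "q \<in> fst d" "q \<notin> fst c \<or> snd c q \<notin> cball u r"
      then show "(f \<circ> chart_inv d) (snd d q) = 0" using d by (auto simp: f_def h_def b(5))
    qed
  qed
  have "(h has_derivative (\<lambda>v. \<phi> u * (v \<bullet> X p) + frechet_derivative \<phi> (at u) v * ((u + (- u)) \<bullet> X p))) (at u)"
    unfolding h_def
    by (intro has_derivative_mult smooth_on_has_derivative[OF b(3)] has_derivative_inner_left)
      (auto intro!: derivative_eq_intros)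
  then have "((f \<circ> chart_inv c) has_derivative
      (\<lambda>v. \<phi> u * (v \<bullet> X p) + frechet_derivative \<phi> (at u) v * ((u + (- u)) \<bullet> X p))) (at (snd c p))"
    unfolding b(1)[folded c_def]
    by (rule has_derivative_transform_within_open[OF _ open_chart_image[OF c(1)]])
      (use c in \<open>auto simp: f_def chart_inv_in_domain\<close>)
  from fun_cong[OF frechet_derivative_at[OF this], of "X p"]
  have "dir_deriv A X f p = \<phi> u * (X p \<bullet> X p)"
    by (simp add: dir_deriv_def c_def)
  then show ?thesis using assms[OF \<open>smooth_fun A f\<close>] b(4) by simp
qed

end

section \<open>Brackets, connections and curvature\<close>

context smooth_manifold begin

lemmas smooth_closure = smooth_fun_const smooth_fun_add smooth_fun_diff smooth_fun_mult
  smooth_fun_dir_deriv smooth_field_add smooth_field_diff smooth_field_minus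
  smooth_field_scaleR smooth_field_scale_const

text \<open>Identities between brackets are derived by letting both sides act on functions.\<close>
lemma vector_eqI:
  assumes "\<And>f. smooth_fun A f \<Longrightarrow> dir_deriv A X f p = dir_deriv A Y f p"
  shows "X p = Y p"
  using smooth_functions_separate_vectors[of "\<lambda>q. X q - Y q" p] assms
  by (simp add: dir_deriv_field_diff)

lemma lie_bracket_antisym: "lie_bracket A X Y p = - lie_bracket A Y X p"
  by (simp add: lie_bracket_def Let_def)

end

text \<open>On the manifolds considered below the bracket is smooth because a torsion-free connection
  expresses it through covariant derivatives.\<close>
locale smooth_brackets = smooth_manifold +
  assumes lie_bracket_smooth: "smooth_field A X \<Longrightarrow> smooth_field A Y \<Longrightarrow> smooth_field A (lie_bracket A X Y)"
begin

lemma lie_bracket_add_left: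
  assumes "smooth_field A X" "smooth_field A X'" "smooth_field A Y"
  shows "lie_bracket A (\<lambda>q. X q + X' q) Y p = lie_bracket A X Y p + lie_bracket A X' Y p"
proof (rule vector_eqI[of "lie_bracket A (\<lambda>q. X q + X' q) Y" p "\<lambda>q. lie_bracket A X Y q + lie_bracket A X' Y q", simplified])
  fix f assume f: "smooth_fun A f"
  have "dir_deriv A (\<lambda>q. X q + X' q) f = (\<lambda>q. dir_deriv A X f q + dir_deriv A X' f q)"
    using dir_deriv_field_add[OF f] by blast
  then show "dir_deriv A (lie_bracket A (\<lambda>q. X q + X' q) Y) f p
      = dir_deriv A (\<lambda>q. lie_bracket A X Y q + lie_bracket A X' Y q) f p"
    using f assms by (simp add: dir_deriv_lie_bracket dir_deriv_field_add dir_deriv_add smooth_closure)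
qed

lemma lie_bracket_scaleR_left:
  assumes k: "smooth_fun A k" and X: "smooth_field A X" and Y: "smooth_field A Y"
  shows "lie_bracket A (\<lambda>q. k q *\<^sub>R X q) Y p = k p *\<^sub>R lie_bracket A X Y p - dir_deriv A Y k p *\<^sub>R X p"
proof -
  have "lie_bracket A (\<lambda>q. k q *\<^sub>R X q) Y p
    = (\<lambda>q. k q *\<^sub>R lie_bracket A X Y q - dir_deriv A Y k q *\<^sub>R X q) p"
  proof (rule vector_eqI)
    fix f assume f: "smooth_fun A f"
    have "dir_deriv A (\<lambda>q. k q *\<^sub>R X q) f = (\<lambda>q. k q * dir_deriv A X f q)"
      using dir_deriv_field_scaleR[OF f] by blast
    then show "dir_deriv A (lie_bracket A (\<lambda>q. k q *\<^sub>R X q) Y) f p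
      = dir_deriv A (\<lambda>q. k q *\<^sub>R lie_bracket A X Y q - dir_deriv A Y k q *\<^sub>R X q) f p"
      using f assms
      by (simp add: dir_deriv_lie_bracket dir_deriv_field_diff dir_deriv_field_scaleR
          dir_deriv_mult smooth_closure algebra_simps)
  qed
  then show ?thesis by simp
qed

lemma lie_bracket_jacobi:
  assumes "smooth_field A X" "smooth_field A Y" "smooth_field A Z"
  shows "lie_bracket A X (lie_bracket A Y Z) p + lie_bracket A Y (lie_bracket A Z X) p
    + lie_bracket A Z (lie_bracket A X Y) p = 0"
proof (rule smooth_functions_separate_vectors[of "\<lambda>p. lie_bracket A X (lie_bracket A Y Z) p
    + lie_bracket A Y (lie_bracket A Z X) p + lie_bracket A Z (lie_bracket A X Y) p"])
  fix f assume f: "smooth_fun A f"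
  have b: "dir_deriv A (lie_bracket A V W) f = (\<lambda>q. dir_deriv A V (dir_deriv A W f) q - dir_deriv A W (dir_deriv A V f) q)"
    if "smooth_field A V" "smooth_field A W" for V W
    using dir_deriv_lie_bracket[OF f that] by blast
  show "dir_deriv A (\<lambda>p. lie_bracket A X (lie_bracket A Y Z) p
    + lie_bracket A Y (lie_bracket A Z X) p + lie_bracket A Z (lie_bracket A X Y) p) f p = 0"
    using f assms
    by (simp add: dir_deriv_field_add b dir_deriv_lie_bracket lie_bracket_smooth dir_deriv_diff smooth_closure)
qed

end

locale smooth_connection = smooth_manifold A
  for A :: "('a::{t2_space,second_countable_topology}, 'm::finite) chart set" +
  fixes D :: "('a, 'm) conn"
  assumes linear_connection: "linear_connection A D"
begin

lemma conn_smooth: "smooth_field A X \<Longrightarrow> smooth_field A Y \<Longrightarrow> smooth_field A (D X Y)"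
  using linear_connection by (simp add: linear_connection_def)

lemma conn_add_left:
  "smooth_field A X \<Longrightarrow> smooth_field A X' \<Longrightarrow> smooth_field A Y \<Longrightarrow>
    D (\<lambda>q. X q + X' q) Y p = D X Y p + D X' Y p"
  using linear_connection by (simp add: linear_connection_def)

lemma conn_add:
  "smooth_field A X \<Longrightarrow> smooth_field A Y \<Longrightarrow> smooth_field A Y' \<Longrightarrow>
    D X (\<lambda>q. Y q + Y' q) p = D X Y p + D X Y' p"
  using linear_connection by (simp add: linear_connection_def)

lemma conn_scaleR_left:
  "smooth_fun A f \<Longrightarrow> smooth_field A X \<Longrightarrow> smooth_field A Y \<Longrightarrow> D (\<lambda>q. f q *\<^sub>R X q) Y p = f p *\<^sub>R D X Y p"
  using linear_connection by (simp add: linear_connection_def)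

lemma conn_scaleR:
  "smooth_fun A f \<Longrightarrow> smooth_field A X \<Longrightarrow> smooth_field A Y \<Longrightarrow>
    D X (\<lambda>q. f q *\<^sub>R Y q) p = dir_deriv A X f p *\<^sub>R Y p + f p *\<^sub>R D X Y p"
  using linear_connection by (simp add: linear_connection_def)

lemma conn_scale_const:
  "smooth_field A X \<Longrightarrow> smooth_field A Y \<Longrightarrow> D X (\<lambda>q. k *\<^sub>R Y q) p = k *\<^sub>R D X Y p"
  using conn_scaleR[OF smooth_fun_const] by (simp add: dir_deriv_const)

lemma conn_diff:
  "smooth_field A X \<Longrightarrow> smooth_field A Y \<Longrightarrow> smooth_field A Y' \<Longrightarrow>
    D X (\<lambda>q. Y q - Y' q) p = D X Y p - D X Y' p"
  using conn_add[of X Y "\<lambda>q. (- 1) *\<^sub>R Y' q"] conn_scale_const[of X Y' "- 1"]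
  by (simp add: smooth_closure)

lemma conn_minus_left:
  "smooth_field A X \<Longrightarrow> smooth_field A Y \<Longrightarrow> D (\<lambda>q. - X q) Y p = - D X Y p"
  using conn_scaleR_left[OF smooth_fun_const, of X Y "- 1"] by simp

lemma conn_diff_left:
  "smooth_field A X \<Longrightarrow> smooth_field A X' \<Longrightarrow> smooth_field A Y \<Longrightarrow>
    D (\<lambda>q. X q - X' q) Y p = D X Y p - D X' Y p"
  using conn_add_left[of X "\<lambda>q. - X' q"] conn_minus_left[of X'] by (simp add: smooth_closure)

lemmas conn_simps = conn_smooth conn_add conn_diff conn_scaleR conn_add_left conn_diff_left conn_scaleR_left

end

locale curved_connection = smooth_connection A D + smooth_brackets A
  for A :: "('a::{t2_space,second_countable_topology}, 'm::finite) chart set" and D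
begin

abbreviation "R \<equiv> curvature A D"
abbreviation "torsion X Y \<equiv> \<lambda>p. D X Y p - D Y X p - lie_bracket A X Y p"

lemma curvature_smooth:
  "smooth_field A X \<Longrightarrow> smooth_field A Y \<Longrightarrow> smooth_field A Z \<Longrightarrow> smooth_field A (R X Y Z)"
  unfolding curvature_def by (simp add: smooth_closure conn_smooth lie_bracket_smooth)

lemma curvature_antisym:
  assumes "smooth_field A X" "smooth_field A Y" "smooth_field A Z"
  shows "R X Y Z p = - R Y X Z p"
proof -
  have "lie_bracket A X Y = (\<lambda>q. - lie_bracket A Y X q)" using lie_bracket_antisym by blast
  then show ?thesis
    using conn_minus_left[OF lie_bracket_smooth, of Y X Z p] assms by (simp add: curvature_def)
qed

lemma curvature_add_1:
  assumes "smooth_field A X" "smooth_field A X'" "smooth_field A Y" "smooth_field A Z"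
  shows "R (\<lambda>q. X q + X' q) Y Z p = R X Y Z p + R X' Y Z p"
proof -
  have "D (\<lambda>q. X q + X' q) Z = (\<lambda>q. D X Z q + D X' Z q)"
    "lie_bracket A (\<lambda>q. X q + X' q) Y = (\<lambda>q. lie_bracket A X Y q + lie_bracket A X' Y q)"
    using conn_add_left lie_bracket_add_left assms by blast+
  then show ?thesis
    using assms by (simp add: curvature_def conn_simps lie_bracket_smooth)
qed

lemma curvature_scaleR_1:
  assumes "smooth_fun A f" "smooth_field A X" "smooth_field A Y" "smooth_field A Z"
  shows "R (\<lambda>q. f q *\<^sub>R X q) Y Z p = f p *\<^sub>R R X Y Z p"
proof -
  have "D (\<lambda>q. f q *\<^sub>R X q) Z = (\<lambda>q. f q *\<^sub>R D X Z q)"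
    "lie_bracket A (\<lambda>q. f q *\<^sub>R X q) Y = (\<lambda>q. f q *\<^sub>R lie_bracket A X Y q - dir_deriv A Y f q *\<^sub>R X q)"
    using conn_scaleR_left lie_bracket_scaleR_left assms by blast+
  then show ?thesis
    using assms by (simp add: curvature_def conn_simps lie_bracket_smooth smooth_closure algebra_simps)
qed

lemma curvature_add_2:
  assumes "smooth_field A X" "smooth_field A Y" "smooth_field A Y'" "smooth_field A Z"
  shows "R X (\<lambda>q. Y q + Y' q) Z p = R X Y Z p + R X Y' Z p"
  using assms curvature_antisym[OF assms(1) smooth_field_add[OF assms(2,3)] assms(4), of p]
    curvature_antisym[OF assms(1,2,4), of p] curvature_antisym[OF assms(1,3,4), of p]
  by (simp add: curvature_add_1)

lemma curvature_scaleR_2: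
  assumes "smooth_fun A f" "smooth_field A X" "smooth_field A Y" "smooth_field A Z"
  shows "R X (\<lambda>q. f q *\<^sub>R Y q) Z p = f p *\<^sub>R R X Y Z p"
  using assms curvature_antisym[OF assms(2) smooth_field_scaleR[OF assms(1,3)] assms(4), of p]
    curvature_antisym[OF assms(2,3,4), of p]
  by (simp add: curvature_scaleR_1)

lemma curvature_add_3:
  assumes "smooth_field A X" "smooth_field A Y" "smooth_field A Z" "smooth_field A Z'"
  shows "R X Y (\<lambda>q. Z q + Z' q) p = R X Y Z p + R X Y Z' p"
proof -
  have "D V (\<lambda>q. Z q + Z' q) = (\<lambda>q. D V Z q + D V Z' q)" if "smooth_field A V" for V
    using conn_add assms that by blast
  then show ?thesis
    using assms by (simp add: curvature_def conn_simps lie_bracket_smooth)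
qed

text \<open>The second derivatives of the factor leave \<open>X (Y f) - Y (X f) - [X, Y] f\<close>, which vanishes.\<close>
lemma curvature_scaleR_3:
  assumes "smooth_fun A f" "smooth_field A X" "smooth_field A Y" "smooth_field A Z"
  shows "R X Y (\<lambda>q. f q *\<^sub>R Z q) p = f p *\<^sub>R R X Y Z p"
proof -
  have "D V (\<lambda>q. f q *\<^sub>R Z q) = (\<lambda>q. dir_deriv A V f q *\<^sub>R Z q + f q *\<^sub>R D V Z q)" if "smooth_field A V" for V
    using conn_scaleR assms that by blast
  then show ?thesis
    using assms by (simp add: curvature_def conn_simps lie_bracket_smooth smooth_closure
        dir_deriv_lie_bracket algebra_simps)
qed

text \<open>With torsion, the cyclic sum of the curvature measures the torsion; the terms that contain no
  torsion add up to the Jacobi identity.\<close>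
lemma bianchi_with_torsion:
  assumes "smooth_field A X" "smooth_field A Y" "smooth_field A Z"
  shows "R X Y Z p + R Y Z X p + R Z X Y p
    = D X (torsion Y Z) p + torsion X (lie_bracket A Y Z) p
    + (D Y (torsion Z X) p + torsion Y (lie_bracket A Z X) p)
    + (D Z (torsion X Y) p + torsion Z (lie_bracket A X Y) p)"
proof -
  have *: "D X (torsion Y Z) p + torsion X (lie_bracket A Y Z) p
    = D X (D Y Z) p - D X (D Z Y) p - D (lie_bracket A Y Z) X p - lie_bracket A X (lie_bracket A Y Z) p"
    if "smooth_field A X" "smooth_field A Y" "smooth_field A Z" for X Y Z
    using that by (simp add: conn_diff conn_smooth lie_bracket_smooth smooth_closure)
  show ?thesis
    unfolding *[OF assms] *[OF assms(2,3,1)] *[OF assms(3,1,2)]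
    using lie_bracket_jacobi[OF assms, of p] by (simp add: curvature_def algebra_simps)
qed

end

section \<open>Eigenspaces of the product structure\<close>

text \<open>The projection \<open>(1 + \<epsilon> L) / 2\<close> onto the eigenspace has trace \<open>n\<close>, whereas a projection whose range
  lies in a line has trace \<open>0\<close> or \<open>1\<close>.\<close>
lemma traceless_involution_eigenspace:
  fixes L :: "real^'m \<Rightarrow> real^'m"
  assumes lin: "linear L" and inv: "\<And>v. L (L v) = v" and tr: "trace (matrix L) = 0"
    and dim: "CARD('m) = 2 * n" "n \<ge> 2" and \<epsilon>: "\<epsilon> * \<epsilon> = (1::real)"
  shows "\<exists>v. L v = \<epsilon> *\<^sub>R v \<and> (\<forall>k. v \<noteq> k *\<^sub>R y)"
proof (rule ccontr)
  assume "\<not> ?thesis"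
  then have line: "\<exists>k. v = k *\<^sub>R y" if "L v = \<epsilon> *\<^sub>R v" for v using that by blast
  define Q where "Q v = (1 / 2) *\<^sub>R (v + \<epsilon> *\<^sub>R L v)" for v
  have linQ: "linear Q"
    unfolding Q_def using lin
    by (intro linear_compose_scale_right linear_compose_add linear_ident)
  have LQ: "L (Q v) = \<epsilon> *\<^sub>R Q v" for v
    unfolding Q_def using lin inv \<epsilon> by (simp add: linear_add linear_scale algebra_simps)
  then have "\<forall>v. \<exists>k. Q v = k *\<^sub>R y" using line by blast
  then obtain l where l: "Q v = l v *\<^sub>R y" for v
    using choice[of "\<lambda>v k. Q v = k *\<^sub>R y"] by blast
  have QQ: "Q (Q v) = Q v" for v
    unfolding Q_def[of "Q v"] LQ by (simp only: scaleR_scaleR \<epsilon> scaleR_one scaleR_half_double)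
  have "(\<Sum>i\<in>UNIV. l (axis i 1) * y $ i) = (\<Sum>i\<in>UNIV. Q (axis i 1) $ i)"
    by (simp add: l)
  also have "\<dots> = (\<Sum>i\<in>(UNIV::'m set). 1 / 2 + \<epsilon> / 2 * L (axis i 1) $ i)"
    by (intro sum.cong) (auto simp: Q_def algebra_simps)
  also have "\<dots> = real n + \<epsilon> / 2 * trace (matrix L)"
    by (simp add: sum.distrib sum_distrib_left trace_def matrix_def dim)
  finally have tr_l: "(\<Sum>i\<in>UNIV. l (axis i 1) * y $ i) = real n" using tr by simp
  have "Q y = Q (\<Sum>i\<in>UNIV. y $ i *\<^sub>R axis i 1)"
    by (simp add: basis_expansion scalar_mult_eq_scaleR[symmetric])
  also have "\<dots> = (\<Sum>i\<in>UNIV. y $ i *\<^sub>R Q (axis i 1))"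
    using linQ by (simp add: linear_sum linear_scale)
  also have "\<dots> = (\<Sum>i\<in>UNIV. l (axis i 1) * y $ i) *\<^sub>R y"
    by (simp add: l scaleR_sum_left mult.commute)
  finally have Qy: "Q y = real n *\<^sub>R y" by (simp add: tr_l)
  then have "real n *\<^sub>R real n *\<^sub>R y = real n *\<^sub>R y" using QQ[of y] linQ by (simp add: linear_scale)
  then have "y = 0" using dim(2) by simp
  then show False using tr_l dim(2) by simp
qed

locale almost_product =
  fixes A :: "('a::{t2_space,second_countable_topology}, 'm::finite) chart set"
    and n :: nat and P :: "('a, 'm) tensor11" and g :: "('a, 'm) tensor02"
  assumes almost_product: "almost_product_manifold A n P g"

sublocale almost_product \<subseteq> smooth_manifold A
  using almost_product by unfold_locales (simp add: almost_product_manifold_def)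

context almost_product begin

lemma dim: "CARD('m) = 2 * n"
  and P_involution: "P p (P p v) = v"
  and P_isometry: "g p (P p v) (P p w) = g p v w"
  and traceless: "trace (matrix (P p)) = 0"
  and P_linear: "linear (P p)"
  and g_bilinear: "bilinear (g p)"
  and g_commute: "g p v w = g p w v"
  and g_positive: "v \<noteq> 0 \<Longrightarrow> g p v v > 0"
  using almost_product
  by (auto simp: almost_product_manifold_def smooth_tensor11_def riemannian_metric_def)

lemma P_smooth: "smooth_field A X \<Longrightarrow> smooth_field A (\<lambda>q. P q (X q))"
  using almost_product by (auto simp: almost_product_manifold_def smooth_tensor11_def app11_def)

lemma g_smooth: "smooth_field A X \<Longrightarrow> smooth_field A Y \<Longrightarrow> smooth_fun A (\<lambda>q. g q (X q) (Y q))"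
  using almost_product by (auto simp: almost_product_manifold_def riemannian_metric_def app02_def)

lemmas P_simps = linear_add[OF P_linear] linear_diff[OF P_linear] linear_neg[OF P_linear]
  linear_scale[OF P_linear] linear_0[OF P_linear] P_involution

lemmas g_simps = bilinear_ladd[OF g_bilinear] bilinear_radd[OF g_bilinear]
  bilinear_lsub[OF g_bilinear] bilinear_rsub[OF g_bilinear]
  bilinear_lneg[OF g_bilinear] bilinear_rneg[OF g_bilinear]
  bilinear_lmul[OF g_bilinear] bilinear_rmul[OF g_bilinear]
  bilinear_lzero[OF g_bilinear] bilinear_rzero[OF g_bilinear]

lemma g_P_left: "g p (P p v) w = g p v (P p w)"
  using P_isometry[of p v "P p w"] by (simp add: P_involution)

lemma g_eq_0_iff: "g p v v = 0 \<longleftrightarrow> v = 0"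
  using g_positive[of v p] by (cases "v = 0") (simp_all add: g_simps)

lemma eigenvectors_orthogonal:
  assumes "\<epsilon> * \<epsilon> = 1" "P p v = \<epsilon> *\<^sub>R v" "P p w = - \<epsilon> *\<^sub>R w"
  shows "g p v w = 0"
proof -
  have "g p v w = - (\<epsilon> * \<epsilon>) * g p v w"
    using P_isometry[of p v w] assms(2,3) by (simp add: g_simps)
  then show ?thesis using assms(1) by simp
qed

lemma eigenfield_exists:
  assumes "n \<ge> 2" and \<epsilon>: "\<epsilon> * \<epsilon> = 1"
  obtains Z where "smooth_field A Z" "\<And>q. P q (Z q) = \<epsilon> *\<^sub>R Z q" "\<And>k. Z p \<noteq> k *\<^sub>R y"
proof -
  obtain v where v: "P p v = \<epsilon> *\<^sub>R v" "\<And>k. v \<noteq> k *\<^sub>R y"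
    using traceless_involution_eigenspace[OF P_linear P_involution traceless dim assms] by blast
  obtain X r where X: "smooth_field A X" "r \<noteq> 0" "X p = r *\<^sub>R v" by (rule smooth_field_through)
  let ?Z = "\<lambda>q. (1 / 2) *\<^sub>R (X q + \<epsilon> *\<^sub>R P q (X q))"
  have "smooth_field A ?Z" using X by (intro smooth_closure P_smooth)
  moreover have "P q (?Z q) = \<epsilon> *\<^sub>R ?Z q" for q
    using \<epsilon> by (simp add: P_simps algebra_simps)
  moreover have Zp: "?Z p = r *\<^sub>R v"
  proof -
    have "\<epsilon> *\<^sub>R r *\<^sub>R \<epsilon> *\<^sub>R v = r *\<^sub>R (\<epsilon> * \<epsilon>) *\<^sub>R v" by simp
    then have "\<epsilon> *\<^sub>R P p (X p) = r *\<^sub>R v" using X v \<epsilon> by (simp only: P_simps) simp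
    then show ?thesis using X(3) by (simp only: scaleR_half_double)
  qed
  moreover have "?Z p \<noteq> k *\<^sub>R y" for k
  proof
    assume "?Z p = k *\<^sub>R y"
    then have "(1 / r) *\<^sub>R r *\<^sub>R v = (1 / r) *\<^sub>R k *\<^sub>R y" using Zp by metis
    then have "v = (1 / r * k) *\<^sub>R y" using X(2) by simp
    then show False using v(2) by blast
  qed
  ultimately show thesis using that by blast
qed

end

section \<open>Natural connections\<close>

text \<open>Apart from being metric and preserving \<open>P\<close>, the connection enters the argument only through its
  torsion, which at each point is determined by \<open>g\<close>, \<open>P\<close>, \<open>\<Omega>\<close> and the two parameters.\<close>
locale almost_product_field = almost_product A n P g
  for A :: "('a::{t2_space,second_countable_topology}, 'm::finite) chart set" and n P g +
  fixes \<Omega> :: "('a, 'm) field" and lam \<mu> :: real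
  assumes n2: "n \<ge> 2" and \<Omega>_smooth: "smooth_field A \<Omega>"
begin

text \<open>The vectors that represent the forms \<open>y \<mapsto> \<lambda> \<theta>(P y) + \<mu> \<theta>(y)\<close> and
  \<open>y \<mapsto> \<lambda> \<theta>(y) + (\<mu> + 1/(2n)) \<theta>(P y)\<close>.\<close>
definition \<alpha> :: "('a, 'm) field" where "\<alpha> p = lam *\<^sub>R P p (\<Omega> p) + \<mu> *\<^sub>R \<Omega> p"
definition \<beta> :: "('a, 'm) field" where "\<beta> p = lam *\<^sub>R \<Omega> p + (\<mu> + 1 / (2 * real n)) *\<^sub>R P p (\<Omega> p)"

definition tors :: "'a \<Rightarrow> real^'m \<Rightarrow> real^'m \<Rightarrow> real^'m" where
  "tors p x y = g p (\<alpha> p) x *\<^sub>R P p y - g p (\<alpha> p) y *\<^sub>R P p x + g p (\<beta> p) x *\<^sub>R y - g p (\<beta> p) y *\<^sub>R x"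

text \<open>The quadratic expression in \<open>\<theta>\<close> that occurs in both conditions: the wedge product of \<open>\<theta> \<circ> P\<close> and
  \<open>\<theta>\<close>.\<close>
definition wedge_\<theta> :: "'a \<Rightarrow> real^'m \<Rightarrow> real^'m \<Rightarrow> real" where
  "wedge_\<theta> p x y = g p (\<Omega> p) (P p x) * g p (\<Omega> p) y - g p (\<Omega> p) x * g p (\<Omega> p) (P p y)"

lemma \<alpha>_smooth: "smooth_field A \<alpha>" and \<beta>_smooth: "smooth_field A \<beta>"
  unfolding \<alpha>_def[abs_def] \<beta>_def[abs_def] by (intro smooth_closure P_smooth \<Omega>_smooth)+

lemma tors_antisym: "tors p x y = - tors p y x"
  by (simp add: tors_def)

lemma tors_diff: "tors p x (y - z) = tors p x y - tors p x z"
  by (simp add: tors_def g_simps P_simps algebra_simps)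

lemma wedge_antisym: "wedge_\<theta> p x y = - wedge_\<theta> p y x"
  by (simp add: wedge_\<theta>_def)

text \<open>This is the source of the quadratic terms of the two conditions. The forms \<open>\<alpha>\<close> and \<open>\<beta>\<close> take
  multiples of the wedge product as values on the torsion, and the remaining terms, collected in \<open>C\<close>
  below, cancel in the cyclic sum.\<close>
lemma tors_tors_cyclic:
  "tors p (tors p y z) x + tors p (tors p z x) y + tors p (tors p x y) z
   = (\<mu> / (2 * real n) * wedge_\<theta> p x y) *\<^sub>R P p z + (lam / (2 * real n) * wedge_\<theta> p x y) *\<^sub>R z
   + (\<mu> / (2 * real n) * wedge_\<theta> p y z) *\<^sub>R P p x + (lam / (2 * real n) * wedge_\<theta> p y z) *\<^sub>R x
   + (\<mu> / (2 * real n) * wedge_\<theta> p z x) *\<^sub>R P p y + (lam / (2 * real n) * wedge_\<theta> p z x) *\<^sub>R y"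
proof -
  define \<kappa> where "\<kappa> = 1 / (2 * real n)"
  define t where "t v = g p (\<Omega> p) v" for v
  define s where "s v = g p (\<Omega> p) (P p v)" for v
  have a: "g p (\<alpha> p) v = lam * s v + \<mu> * t v" and b: "g p (\<beta> p) v = lam * t v + (\<mu> + \<kappa>) * s v" for v
    by (simp_all add: \<alpha>_def \<beta>_def g_simps g_P_left t_def s_def \<kappa>_def)
  have sP: "s (P p v) = t v" and tP: "t (P p v) = s v" for v
    by (simp_all add: t_def s_def P_simps)
  have w: "wedge_\<theta> p u v = s u * t v - t u * s v" for u v by (simp add: wedge_\<theta>_def t_def s_def)
  have k: "\<mu> / (2 * real n) = \<mu> * \<kappa>" "lam / (2 * real n) = lam * \<kappa>" by (simp_all add: \<kappa>_def)
  have \<alpha>T: "g p (\<alpha> p) (tors p u v) = \<mu> / (2 * real n) * wedge_\<theta> p u v" for u v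
  proof -
    have "g p (\<alpha> p) (tors p u v) = g p (\<alpha> p) u * g p (\<alpha> p) (P p v) - g p (\<alpha> p) v * g p (\<alpha> p) (P p u)
        + g p (\<beta> p) u * g p (\<alpha> p) v - g p (\<beta> p) v * g p (\<alpha> p) u"
      by (simp add: tors_def g_simps)
    then show ?thesis unfolding a b sP tP w k by (simp add: algebra_simps)
  qed
  have \<beta>T: "g p (\<beta> p) (tors p u v) = lam / (2 * real n) * wedge_\<theta> p u v" for u v
  proof -
    have "g p (\<beta> p) (tors p u v) = g p (\<alpha> p) u * g p (\<beta> p) (P p v) - g p (\<alpha> p) v * g p (\<beta> p) (P p u)"
      by (simp add: tors_def g_simps)
    then show ?thesis unfolding a b sP tP w k by (simp add: algebra_simps)
  qed
  define C where "C x u v = g p (\<alpha> p) x *\<^sub>R P p (tors p u v) + g p (\<beta> p) x *\<^sub>R tors p u v" for x u v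
  have TT: "tors p (tors p u v) x
      = (\<mu> / (2 * real n) * wedge_\<theta> p u v) *\<^sub>R P p x + (lam / (2 * real n) * wedge_\<theta> p u v) *\<^sub>R x - C x u v"
    for u v x
    unfolding \<alpha>T[symmetric] \<beta>T[symmetric] C_def tors_def[of p "tors p u v" x] by simp
  have "C x y z + C y z x + C z x y = 0"
    by (simp add: C_def tors_def P_simps algebra_simps)
  moreover have "tors p (tors p y z) x + tors p (tors p z x) y + tors p (tors p x y) z
   = (\<mu> / (2 * real n) * wedge_\<theta> p x y) *\<^sub>R P p z + (lam / (2 * real n) * wedge_\<theta> p x y) *\<^sub>R z
   + (\<mu> / (2 * real n) * wedge_\<theta> p y z) *\<^sub>R P p x + (lam / (2 * real n) * wedge_\<theta> p y z) *\<^sub>R x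
   + (\<mu> / (2 * real n) * wedge_\<theta> p z x) *\<^sub>R P p y + (lam / (2 * real n) * wedge_\<theta> p z x) *\<^sub>R y
   - (C x y z + C y z x + C z x y)"
    unfolding TT by simp
  ultimately show ?thesis by simp
qed

end

locale natural_connection = almost_product_field A n P g \<Omega> lam \<mu> + curved_connection A D
  for A :: "('a::{t2_space,second_countable_topology}, 'm::finite) chart set"
    and n P g \<Omega> lam \<mu> D +
  assumes metric: "smooth_field A X \<Longrightarrow> smooth_field A Y \<Longrightarrow> smooth_field A Z \<Longrightarrow>
      dir_deriv A X (\<lambda>q. g q (Y q) (Z q)) p = g p (D X Y p) (Z p) + g p (Y p) (D X Z p)"
    and parallel: "smooth_field A X \<Longrightarrow> smooth_field A Y \<Longrightarrow> D X (\<lambda>q. P q (Y q)) p = P p (D X Y p)"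
    and torsion_eq: "smooth_field A X \<Longrightarrow> smooth_field A Y \<Longrightarrow>
      D X Y p - D Y X p - lie_bracket A X Y p = tors p (X p) (Y p)"
begin

text \<open>The left-hand sides of the two conditions: \<open>g(\<nabla>_X \<alpha>, W)\<close> is \<open>V(X, W)\<close>, and \<open>g(\<nabla>_X \<beta>, W)\<close> is
  \<open>U(X, W)\<close>.\<close>
definition V_skew :: "('a, 'm) field \<Rightarrow> ('a, 'm) field \<Rightarrow> 'a \<Rightarrow> real" where
  "V_skew X Y p = g p (D X \<alpha> p) (Y p) - g p (D Y \<alpha> p) (X p) + \<mu> / (2 * real n) * wedge_\<theta> p (X p) (Y p)"

definition U_skew :: "('a, 'm) field \<Rightarrow> ('a, 'm) field \<Rightarrow> 'a \<Rightarrow> real" where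
  "U_skew X Y p = g p (D X \<beta> p) (Y p) - g p (D Y \<beta> p) (X p) + lam / (2 * real n) * wedge_\<theta> p (X p) (Y p)"

lemma conn_\<alpha>: "smooth_field A X \<Longrightarrow> D X \<alpha> p = lam *\<^sub>R P p (D X \<Omega> p) + \<mu> *\<^sub>R D X \<Omega> p"
  and conn_\<beta>: "smooth_field A X \<Longrightarrow> D X \<beta> p = lam *\<^sub>R D X \<Omega> p + (\<mu> + 1 / (2 * real n)) *\<^sub>R P p (D X \<Omega> p)"
  unfolding \<alpha>_def[abs_def] \<beta>_def[abs_def]
  by (simp_all add: conn_add conn_scale_const smooth_closure P_smooth \<Omega>_smooth parallel)

lemma conn_tors:
  assumes "smooth_field A X" "smooth_field A Y" "smooth_field A Z"
  shows "D X (\<lambda>q. tors q (Y q) (Z q)) p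
    = g p (D X \<alpha> p) (Y p) *\<^sub>R P p (Z p) - g p (D X \<alpha> p) (Z p) *\<^sub>R P p (Y p)
      + g p (D X \<beta> p) (Y p) *\<^sub>R Z p - g p (D X \<beta> p) (Z p) *\<^sub>R Y p
      + tors p (D X Y p) (Z p) + tors p (Y p) (D X Z p)"
proof -
  have *: "D X (\<lambda>q. g q (\<gamma> q) (Y q) *\<^sub>R W q) p
      = (g p (D X \<gamma> p) (Y p) + g p (\<gamma> p) (D X Y p)) *\<^sub>R W p + g p (\<gamma> p) (Y p) *\<^sub>R D X W p"
    if "smooth_field A \<gamma>" "smooth_field A Y" "smooth_field A W" for \<gamma> Y W
    using that assms(1) by (simp add: conn_scaleR g_smooth metric)
  have "D X (\<lambda>q. tors q (Y q) (Z q)) p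
    = D X (\<lambda>q. g q (\<alpha> q) (Y q) *\<^sub>R P q (Z q)) p - D X (\<lambda>q. g q (\<alpha> q) (Z q) *\<^sub>R P q (Y q)) p
      + D X (\<lambda>q. g q (\<beta> q) (Y q) *\<^sub>R Z q) p - D X (\<lambda>q. g q (\<beta> q) (Z q) *\<^sub>R Y q) p"
    unfolding tors_def using assms
    by (simp add: conn_add conn_diff smooth_closure g_smooth P_smooth \<alpha>_smooth \<beta>_smooth)
  then show ?thesis
    using assms by (simp add: * P_smooth \<alpha>_smooth \<beta>_smooth parallel tors_def scaleR_add_left)
qed

text \<open>In the Bianchi identity with torsion, the brackets are expressed by covariant derivatives and
  the torsion. The terms in which the torsion is applied to a covariant derivative then cancel
  cyclically; what is left are the derivatives of \<open>\<alpha>\<close> and \<open>\<beta>\<close> and the iterated torsion.\<close>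
lemma bianchi_sum:
  assumes "smooth_field A X" "smooth_field A Y" "smooth_field A Z"
  shows "R X Y Z p + R Y Z X p + R Z X Y p
    = V_skew X Y p *\<^sub>R P p (Z p) + U_skew X Y p *\<^sub>R Z p
    + (V_skew Y Z p *\<^sub>R P p (X p) + U_skew Y Z p *\<^sub>R X p)
    + (V_skew Z X p *\<^sub>R P p (Y p) + U_skew Z X p *\<^sub>R Y p)"
proof -
  have T: "torsion V W = (\<lambda>q. tors q (V q) (W q))" if "smooth_field A V" "smooth_field A W" for V W
    using torsion_eq[OF that] by blast
  have B: "tors p (V p) (lie_bracket A W W' p)
      = tors p (V p) (D W W' p) - tors p (V p) (D W' W p) + tors p (tors p (W p) (W' p)) (V p)"
    if "smooth_field A W" "smooth_field A W'" for V W W'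
  proof -
    have "lie_bracket A W W' p = D W W' p - D W' W p - tors p (W p) (W' p)"
      using torsion_eq[OF that] by (simp add: algebra_simps)
    then show ?thesis using tors_antisym[of p "V p" "tors p (W p) (W' p)"] by (simp add: tors_diff)
  qed
  have C: "D V (torsion W W') p + torsion V (lie_bracket A W W') p
    = g p (D V \<alpha> p) (W p) *\<^sub>R P p (W' p) - g p (D V \<alpha> p) (W' p) *\<^sub>R P p (W p)
      + g p (D V \<beta> p) (W p) *\<^sub>R W' p - g p (D V \<beta> p) (W' p) *\<^sub>R W p
      + tors p (W p) (D V W' p) - tors p (W' p) (D V W p)
      + tors p (V p) (D W W' p) - tors p (V p) (D W' W p) + tors p (tors p (W p) (W' p)) (V p)"
    if "smooth_field A V" "smooth_field A W" "smooth_field A W'" for V W W'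
    unfolding T[OF that(2,3)] torsion_eq[OF that(1) lie_bracket_smooth[OF that(2,3)]]
      conn_tors[OF that] B[OF that(2,3)]
    using tors_antisym[of p "D V W p" "W' p"] by simp
  show ?thesis
    unfolding bianchi_with_torsion[OF assms] C[OF assms] C[OF assms(2,3,1)] C[OF assms(3,1,2)]
    using tors_tors_cyclic[of p "Y p" "Z p" "X p"]
    by (simp add: V_skew_def U_skew_def algebra_simps)
qed

text \<open>The function \<open>g(Z, W)\<close> is differentiated along \<open>X\<close> and \<open>Y\<close> in both orders and along \<open>[X, Y]\<close>.\<close>
lemma curvature_skew:
  assumes "smooth_field A X" "smooth_field A Y" "smooth_field A Z" "smooth_field A W"
  shows "g p (R X Y Z p) (W p) = - g p (Z p) (R X Y W p)"
proof -
  have m: "dir_deriv A V (\<lambda>q. g q (Z q) (W q)) = (\<lambda>q. g q (D V Z q) (W q) + g q (Z q) (D V W q))"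
    if "smooth_field A V" for V
    using metric assms(3,4) that by blast
  have "dir_deriv A (lie_bracket A X Y) (\<lambda>q. g q (Z q) (W q)) p
    = dir_deriv A X (dir_deriv A Y (\<lambda>q. g q (Z q) (W q))) p
      - dir_deriv A Y (dir_deriv A X (\<lambda>q. g q (Z q) (W q))) p"
    using assms by (intro dir_deriv_lie_bracket g_smooth)
  then show ?thesis
    using assms
    by (simp add: m lie_bracket_smooth dir_deriv_add g_smooth conn_smooth metric curvature_def g_simps)
qed

lemma curvature_P:
  assumes "smooth_field A X" "smooth_field A Y" "smooth_field A Z"
  shows "R X Y (\<lambda>q. P q (Z q)) p = P p (R X Y Z p)"
proof -
  have "D V (\<lambda>q. P q (Z q)) = (\<lambda>q. P q (D V Z q))" if "smooth_field A V" for V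
    using parallel assms(3) that by blast
  then show ?thesis
    using assms by (simp add: curvature_def parallel conn_smooth lie_bracket_smooth P_simps)
qed

lemma V_skew_antisym: "V_skew X Y p = - V_skew Y X p" and U_skew_antisym: "U_skew X Y p = - U_skew Y X p"
  using wedge_antisym[of p "X p" "Y p"] by (simp_all add: V_skew_def U_skew_def)

lemma V_skew_add: "smooth_field A X \<Longrightarrow> smooth_field A X' \<Longrightarrow>
    V_skew (\<lambda>q. X q + X' q) Y p = V_skew X Y p + V_skew X' Y p"
  and U_skew_add: "smooth_field A X \<Longrightarrow> smooth_field A X' \<Longrightarrow>
    U_skew (\<lambda>q. X q + X' q) Y p = U_skew X Y p + U_skew X' Y p"
  by (simp_all add: V_skew_def U_skew_def wedge_\<theta>_def conn_add_left \<alpha>_smooth \<beta>_smooth g_simps P_simps algebra_simps)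

text \<open>If the eigenspaces have dimension \<open>2\<close>, the Bianchi identity gives no information about two fields
  of the same eigenbundle, since a third one in it depends on them linearly. The claim holds without the
  Bianchi identity. Pairing the cyclic sum with \<open>Z\<close> yields one linear relation between \<open>U_skew\<close> and
  \<open>V_skew\<close>; on fields of the same eigenbundle both are multiples of one number \<open>\<sigma>\<close>, and the relation
  is \<open>\<epsilon> \<sigma> / (2n) = 0\<close>.\<close>
lemma forms_vanish_on_eigenfields:
  assumes X: "smooth_field A X" and Y: "smooth_field A Y" and \<epsilon>: "\<epsilon> * \<epsilon> = 1"
    and PX: "\<And>q. P q (X q) = \<epsilon> *\<^sub>R X q" and PY: "\<And>q. P q (Y q) = \<epsilon> *\<^sub>R Y q"
  shows "V_skew X Y p = 0 \<and> U_skew X Y p = 0"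
proof -
  have \<epsilon>': "(- \<epsilon>) * (- \<epsilon>) = 1" using \<epsilon> by simp
  obtain Z where Z: "smooth_field A Z" "\<And>q. P q (Z q) = (- \<epsilon>) *\<^sub>R Z q" "\<And>k. Z p \<noteq> k *\<^sub>R 0"
    using eigenfield_exists[OF n2 \<epsilon>'] by blast
  have eig: "P p (R V W T p) = \<epsilon> *\<^sub>R R V W T p"
    if "smooth_field A V" "smooth_field A W" "smooth_field A T" "\<And>q. P q (T q) = \<epsilon> *\<^sub>R T q" for V W T
    using curvature_P[OF that(1-3), of p] curvature_scaleR_3[OF smooth_fun_const that(1-3), of \<epsilon> p]
    by (simp add: that(4))
  have orth: "g p v (Z p) = 0" if "P p v = \<epsilon> *\<^sub>R v" for v
    using eigenvectors_orthogonal[OF \<epsilon> that] Z(2) by simp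
  have "g p (R X Y Z p) (Z p) = 0"
    using curvature_skew[OF X Y Z(1) Z(1), of p] g_commute[of p "Z p"] by simp
  moreover have "g p (R Y Z X p) (Z p) = 0" "g p (R Z X Y p) (Z p) = 0" "g p (X p) (Z p) = 0" "g p (Y p) (Z p) = 0"
    using X Y Z(1) PX PY by (auto intro!: orth eig)
  ultimately have "(U_skew X Y p - \<epsilon> * V_skew X Y p) * g p (Z p) (Z p) = 0"
    using arg_cong[OF bianchi_sum[OF X Y Z(1), of p], of "\<lambda>v. g p v (Z p)"]
    by (simp add: g_simps PX PY Z(2) algebra_simps) auto
  then have 1: "U_skew X Y p = \<epsilon> * V_skew X Y p" using Z(3)[of 0] by (simp add: g_eq_0_iff)
  define \<sigma> where "\<sigma> = g p (D X \<Omega> p) (Y p) - g p (D Y \<Omega> p) (X p)"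
  have w: "wedge_\<theta> p (X p) (Y p) = 0" by (simp add: wedge_\<theta>_def PX PY g_simps)
  have V: "V_skew X Y p = (\<epsilon> * lam + \<mu>) * \<sigma>"
    using X Y by (simp add: V_skew_def conn_\<alpha> w \<sigma>_def g_simps g_P_left PX PY algebra_simps)
  have U: "U_skew X Y p = (lam + \<epsilon> * (\<mu> + 1 / (2 * real n))) * \<sigma>"
    using X Y by (simp add: U_skew_def conn_\<beta> w \<sigma>_def g_simps g_P_left PX PY algebra_simps)
  have "(lam + \<epsilon> * (\<mu> + 1 / (2 * real n)) - \<epsilon> * (\<epsilon> * lam + \<mu>)) * \<sigma> = 0"
    using 1 unfolding U V by (simp add: algebra_simps)
  moreover have "lam + \<epsilon> * (\<mu> + 1 / (2 * real n)) - \<epsilon> * (\<epsilon> * lam + \<mu>) = \<epsilon> * (1 / (2 * real n))"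
    using \<epsilon> by algebra
  moreover have "\<epsilon> \<noteq> 0" using \<epsilon> by auto
  ultimately have "\<sigma> = 0" using n2 by simp
  then show ?thesis using U V by simp
qed

text \<open>For \<open>X\<close> and \<open>Y\<close> in different eigenbundles, \<open>Z\<close> is taken in that of \<open>Y\<close> and independent of \<open>Y\<close>. The
  cyclic sum is then a combination of \<open>Z\<close> and \<open>Y\<close> alone, because the coefficient of \<open>X\<close> belongs to
  the pair \<open>Y, Z\<close> from one eigenbundle.\<close>
lemma forms_vanish:
  assumes bianchi: "\<And>X Y Z p. smooth_field A X \<Longrightarrow> smooth_field A Y \<Longrightarrow> smooth_field A Z \<Longrightarrow>
      R X Y Z p + R Y Z X p + R Z X Y p = 0"
    and X: "smooth_field A X" and Y: "smooth_field A Y"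
  shows "V_skew X Y p = 0 \<and> U_skew X Y p = 0"
proof -
  have mixed: "\<epsilon> * V_skew X Y p + U_skew X Y p = 0"
    if X: "smooth_field A X" and Y: "smooth_field A Y" and \<epsilon>: "\<epsilon> * \<epsilon> = 1"
      and PX: "\<And>q. P q (X q) = (- \<epsilon>) *\<^sub>R X q" and PY: "\<And>q. P q (Y q) = \<epsilon> *\<^sub>R Y q" for X Y \<epsilon>
  proof (rule ccontr)
    let ?c = "\<epsilon> * V_skew X Y p + U_skew X Y p"
    assume c: "?c \<noteq> 0"
    obtain Z where Z: "smooth_field A Z" "\<And>q. P q (Z q) = \<epsilon> *\<^sub>R Z q" "\<And>k. Z p \<noteq> k *\<^sub>R Y p"
      using eigenfield_exists[OF n2 \<epsilon>] by blast
    have "V_skew Y Z p = 0 \<and> U_skew Y Z p = 0" using forms_vanish_on_eigenfields[OF Y Z(1) \<epsilon> PY Z(2)] .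
    then have "?c *\<^sub>R Z p + (\<epsilon> * V_skew Z X p + U_skew Z X p) *\<^sub>R Y p = 0"
      using bianchi_sum[OF X Y Z(1), of p] bianchi[OF X Y Z(1), of p]
      by (simp add: PY Z(2) algebra_simps)
    then have "?c *\<^sub>R Z p = (- (\<epsilon> * V_skew Z X p + U_skew Z X p)) *\<^sub>R Y p"
      by (simp only: eq_neg_iff_add_eq_0 scaleR_minus_left)
    then have "(1 / ?c) *\<^sub>R ?c *\<^sub>R Z p = (1 / ?c) *\<^sub>R (- (\<epsilon> * V_skew Z X p + U_skew Z X p)) *\<^sub>R Y p"
      by simp
    then have "Z p = ((1 / ?c) * (- (\<epsilon> * V_skew Z X p + U_skew Z X p))) *\<^sub>R Y p"
      using c by simp
    then show False using Z(3) by blast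
  qed
  \<comment> \<open>The projections of a field to the two eigenbundles.\<close>
  define pr where "pr \<epsilon> X q = (1 / 2) *\<^sub>R (X q + \<epsilon> *\<^sub>R P q (X q))" for \<epsilon> and X :: "('a, 'm) field" and q
  have pr_smooth: "smooth_field A (pr \<epsilon> X)" if "smooth_field A X" for \<epsilon> X
    unfolding pr_def[abs_def] using that by (intro smooth_closure P_smooth)
  have pr_P: "P q (pr \<epsilon> X q) = \<epsilon> *\<^sub>R pr \<epsilon> X q" if "\<epsilon> * \<epsilon> = 1" for \<epsilon> X q
    unfolding pr_def using that by (simp add: P_simps algebra_simps)
  have split: "X = (\<lambda>q. pr 1 X q + pr (- 1) X q)" for X
    by (auto simp: pr_def scaleR_2[symmetric] algebra_simps)
  have pp: "V_skew (pr \<epsilon> X) (pr \<epsilon> Y) p = 0 \<and> U_skew (pr \<epsilon> X) (pr \<epsilon> Y) p = 0" if "\<epsilon> * \<epsilon> = 1" for \<epsilon>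
    using X Y that by (intro forms_vanish_on_eigenfields[where \<epsilon> = \<epsilon>] pr_smooth) (simp_all add: pr_P)
  have pm: "V_skew (pr (- 1) X) (pr 1 Y) p = 0 \<and> U_skew (pr (- 1) X) (pr 1 Y) p = 0"
    if "smooth_field A X" "smooth_field A Y" for X Y
  proof -
    have "1 * V_skew (pr (- 1) X) (pr 1 Y) p + U_skew (pr (- 1) X) (pr 1 Y) p = 0"
      using that by (intro mixed pr_smooth) (auto simp: pr_P)
    moreover have "(- 1) * V_skew (pr 1 Y) (pr (- 1) X) p + U_skew (pr 1 Y) (pr (- 1) X) p = 0"
      using that by (intro mixed pr_smooth) (auto simp: pr_P)
    ultimately show ?thesis
      using V_skew_antisym[of "pr 1 Y" "pr (- 1) X" p] U_skew_antisym[of "pr 1 Y" "pr (- 1) X" p] by simp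
  qed
  have add_right: "V_skew W (\<lambda>q. pr 1 Y q + pr (- 1) Y q) p = V_skew W (pr 1 Y) p + V_skew W (pr (- 1) Y) p"
    "U_skew W (\<lambda>q. pr 1 Y q + pr (- 1) Y q) p = U_skew W (pr 1 Y) p + U_skew W (pr (- 1) Y) p" for W
    using V_skew_add[of "pr 1 Y" "pr (- 1) Y" W p] U_skew_add[of "pr 1 Y" "pr (- 1) Y" W p] Y
      V_skew_antisym[of W _ p] U_skew_antisym[of W _ p] by (simp_all add: pr_smooth)
  have "V_skew X Y p = V_skew (pr 1 X) Y p + V_skew (pr (- 1) X) Y p" "U_skew X Y p = U_skew (pr 1 X) Y p + U_skew (pr (- 1) X) Y p"
    using V_skew_add[of "pr 1 X" "pr (- 1) X" Y p] U_skew_add[of "pr 1 X" "pr (- 1) X" Y p] X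
    by (simp_all add: pr_smooth split[of X, symmetric])
  moreover have "V_skew W Y p = V_skew W (pr 1 Y) p + V_skew W (pr (- 1) Y) p" "U_skew W Y p = U_skew W (pr 1 Y) p + U_skew W (pr (- 1) Y) p" for W
    using add_right by (simp_all add: split[of Y, symmetric])
  moreover have "V_skew (pr 1 X) (pr (- 1) Y) p = 0" "U_skew (pr 1 X) (pr (- 1) Y) p = 0"
    using pm[OF Y X] V_skew_antisym[of "pr 1 X" "pr (- 1) Y" p] U_skew_antisym[of "pr 1 X" "pr (- 1) Y" p] by simp_all
  ultimately show ?thesis using pp[of 1] pp[of "- 1"] pm[OF X Y] by simp
qed

lemma curvature04_eq: "curvature04 A g D X Y Z W p = g p (R X Y Z p) (W p)"
  by (simp add: curvature04_def app02_def)

lemma curvature04_tensor_field: "tensor_field04 A (curvature04 A g D)"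
  unfolding tensor_field04_def tensorial_def
  by (intro conjI allI impI ext)
    (simp_all add: curvature04_eq[abs_def] curvature_smooth g_smooth g_simps smooth_closure
      curvature_add_1 curvature_add_2 curvature_add_3 curvature_scaleR_1 curvature_scaleR_2 curvature_scaleR_3)

text \<open>To pass from the Bianchi identity for the \<open>(0,4)\<close>-tensor to vectors, the cyclic sum is paired
  with itself.\<close>
lemma curvature_P_tensor_iff_bianchi:
  "riemannian_P_tensor A P (curvature04 A g D) \<longleftrightarrow>
    (\<forall>X Y Z p. smooth_field A X \<longrightarrow> smooth_field A Y \<longrightarrow> smooth_field A Z \<longrightarrow>
      R X Y Z p + R Y Z X p + R Z X Y p = 0)" (is "?l \<longleftrightarrow> ?r")
proof
  assume ?l
  show ?r
  proof (intro allI impI)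
    fix X Y Z p
    assume XYZ: "smooth_field A X" "smooth_field A Y" "smooth_field A Z"
    define W where "W q = R X Y Z q + R Y Z X q + R Z X Y q" for q
    have "smooth_field A W"
      unfolding W_def[abs_def] using XYZ by (intro smooth_closure curvature_smooth)
    then have "curvature04 A g D X Y Z W p + curvature04 A g D Y Z X W p + curvature04 A g D Z X Y W p = 0"
      using \<open>?l\<close> XYZ unfolding riemannian_P_tensor_def by blast
    then have "g p (W p) (W p) = 0"
      unfolding curvature04_eq by (simp add: W_def[of p] g_simps)
    then show "R X Y Z p + R Y Z X p + R Z X Y p = 0" by (simp add: g_eq_0_iff W_def)
  qed
next
  assume r: ?r
  show ?l
    unfolding riemannian_P_tensor_def
  proof (intro conjI allI impI)
    fix X Y Z W p
    assume X: "smooth_field A X" and Y: "smooth_field A Y" and Z: "smooth_field A Z" and W: "smooth_field A W"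
    show "curvature04 A g D X Y Z W p = - curvature04 A g D Y X Z W p"
      using curvature_antisym[OF X Y Z, of p] by (simp add: curvature04_eq g_simps)
    show "curvature04 A g D X Y Z W p = - curvature04 A g D X Y W Z p"
      using curvature_skew[OF X Y Z W, of p] g_commute[of p "Z p"] by (simp add: curvature04_eq)
    show "curvature04 A g D X Y Z W p + curvature04 A g D Y Z X W p + curvature04 A g D Z X Y W p = 0"
    proof -
      have "R X Y Z p + R Y Z X p + R Z X Y p = 0" using r X Y Z by blast
      then have "g p (R X Y Z p + R Y Z X p + R Z X Y p) (W p) = 0"
        by (simp only: bilinear_lzero[OF g_bilinear])
      then show ?thesis by (simp add: curvature04_eq g_simps)
    qed
    show "curvature04 A g D X Y (app11 P Z) (app11 P W) p = curvature04 A g D X Y Z W p"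
      using curvature_P[OF X Y Z, of p] by (simp add: curvature04_eq app11_def P_isometry)
  qed (rule curvature04_tensor_field)
qed

lemma curvature_P_tensor_iff:
  "riemannian_P_tensor A P (curvature04 A g D) \<longleftrightarrow>
    (\<forall>Y Z. smooth_field A Y \<longrightarrow> smooth_field A Z \<longrightarrow> (\<forall>p. U_skew Y Z p = 0 \<and> V_skew Y Z p = 0))"
  unfolding curvature_P_tensor_iff_bianchi
proof
  assume "\<forall>X Y Z p. smooth_field A X \<longrightarrow> smooth_field A Y \<longrightarrow> smooth_field A Z \<longrightarrow>
      R X Y Z p + R Y Z X p + R Z X Y p = 0"
  then show "\<forall>Y Z. smooth_field A Y \<longrightarrow> smooth_field A Z \<longrightarrow> (\<forall>p. U_skew Y Z p = 0 \<and> V_skew Y Z p = 0)"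
    using forms_vanish by blast
next
  assume "\<forall>Y Z. smooth_field A Y \<longrightarrow> smooth_field A Z \<longrightarrow> (\<forall>p. U_skew Y Z p = 0 \<and> V_skew Y Z p = 0)"
  then show "\<forall>X Y Z p. smooth_field A X \<longrightarrow> smooth_field A Y \<longrightarrow> smooth_field A Z \<longrightarrow>
      R X Y Z p + R Y Z X p + R Z X Y p = 0"
    by (simp add: bianchi_sum)
qed

end

section \<open>The two-parametric family on a W1-manifold\<close>

locale W1_natural =
  fixes A :: "('a::{t2_space,second_countable_topology}, 'm::finite) chart set"
    and n P g and nab :: "('a, 'm) conn" and \<theta> :: "('a, 'm) form" and \<Omega> and lam \<mu> :: real
  assumes n_ge_2: "n \<ge> 2" and W1: "W1_manifold A n P g nab" and \<theta>: "\<theta> = lee_form A P g nab"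
    and dual: "dual_field A g \<theta> \<Omega>"

sublocale W1_natural \<subseteq> almost_product_field A n P g \<Omega> lam \<mu>
  using W1 n_ge_2 dual by unfold_locales (simp_all add: W1_manifold_def dual_field_def)

sublocale W1_natural \<subseteq> LC: smooth_connection A nab
  using W1 by unfold_locales (simp add: W1_manifold_def levi_civita_def)

sublocale W1_natural \<subseteq> smooth_brackets A
proof
  fix X Y assume *: "smooth_field A X" "smooth_field A Y"
  then have "(\<lambda>p. nab X Y p - nab Y X p) = lie_bracket A X Y"
    using W1 unfolding W1_manifold_def levi_civita_def by blast
  moreover have "smooth_field A (\<lambda>p. nab X Y p - nab Y X p)"
    using * by (intro smooth_closure LC.conn_smooth)
  ultimately show "smooth_field A (lie_bracket A X Y)" by simp
qed

context W1_natural begin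

abbreviation "nab' \<equiv> natural_conn n P g nab \<theta> \<Omega> lam \<mu>"

lemma \<theta>_eq: "smooth_field A X \<Longrightarrow> \<theta> X = (\<lambda>p. g p (\<Omega> p) (X p))"
  using dual by (simp add: dual_field_def app02_def)

lemma app11_smooth: "smooth_field A X \<Longrightarrow> smooth_field A (app11 P X)"
  by (simp add: app11_def P_smooth)

lemma torsion_free:
  assumes "smooth_field A X" "smooth_field A Y"
  shows "lie_bracket A X Y p = nab X Y p - nab Y X p"
proof -
  have "(\<lambda>p. nab X Y p - nab Y X p) = lie_bracket A X Y"
    using W1 assms unfolding W1_manifold_def levi_civita_def by blast
  then show ?thesis by metis
qed

lemma nab_metric:
  assumes "smooth_field A X" "smooth_field A Y" "smooth_field A Z"
  shows "dir_deriv A X (\<lambda>q. g q (Y q) (Z q)) p = g p (nab X Y p) (Z p) + g p (Y p) (nab X Z p)"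
proof -
  have "dir_deriv A X (app02 g Y Z) = (\<lambda>p. app02 g (nab X Y) Z p + app02 g Y (nab X Z) p)"
    using W1 assms unfolding W1_manifold_def levi_civita_def by blast
  then show ?thesis by (simp add: app02_def)
qed

text \<open>The defining equation of the class W1, with its last argument removed: the difference of the two
  sides is a smooth field, and the equation is evaluated with this field as last argument.\<close>
lemma nab_P:
  assumes X: "smooth_field A X" and Y: "smooth_field A Y"
  shows "nab X (\<lambda>q. P q (Y q)) p = P p (nab X Y p) + (1 / (2 * real n)) *\<^sub>R
    (g p (X p) (Y p) *\<^sub>R \<Omega> p - g p (X p) (P p (Y p)) *\<^sub>R P p (\<Omega> p)
     + g p (\<Omega> p) (Y p) *\<^sub>R X p - g p (\<Omega> p) (P p (Y p)) *\<^sub>R P p (X p))"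
proof -
  define \<delta> where "\<delta> q = nab X (\<lambda>q. P q (Y q)) q - P q (nab X Y q) - (1 / (2 * real n)) *\<^sub>R
    (g q (X q) (Y q) *\<^sub>R \<Omega> q - g q (X q) (P q (Y q)) *\<^sub>R P q (\<Omega> q)
     + g q (\<Omega> q) (Y q) *\<^sub>R X q - g q (\<Omega> q) (P q (Y q)) *\<^sub>R P q (X q))" for q
  have \<delta>: "smooth_field A \<delta>"
    unfolding \<delta>_def[abs_def] using X Y
    by (intro smooth_closure LC.conn_smooth P_smooth g_smooth \<Omega>_smooth)
  have "tensor_F P g nab X Y \<delta> p = 1 / (2 * real n) *
     (app02 g X Y p * \<theta> \<delta> p - app02 g X (app11 P Y) p * \<theta> (app11 P \<delta>) p
      + app02 g X \<delta> p * \<theta> Y p - app02 g X (app11 P \<delta>) p * \<theta> (app11 P Y) p)"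
    using W1 X Y \<delta> unfolding W1_manifold_def Let_def \<theta> by blast
  then have "g p (nab X (\<lambda>q. P q (Y q)) p - P p (nab X Y p)) (\<delta> p) = 1 / (2 * real n) *
     (g p (X p) (Y p) * g p (\<Omega> p) (\<delta> p) - g p (X p) (P p (Y p)) * g p (\<Omega> p) (P p (\<delta> p))
      + g p (X p) (\<delta> p) * g p (\<Omega> p) (Y p) - g p (X p) (P p (\<delta> p)) * g p (\<Omega> p) (P p (Y p)))"
    using X Y \<delta> by (simp add: tensor_F_def app02_def cov_deriv11_def \<theta>_eq app11_smooth) (simp add: app11_def)
  then have "g p (\<delta> p) (\<delta> p) = 0"
    by (subst (1) \<delta>_def) (simp add: g_simps g_P_left algebra_simps)
  then have "\<delta> p = 0" by (simp add: g_eq_0_iff)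
  then show ?thesis unfolding \<delta>_def by (simp add: diff_eq_eq add.commute)
qed

lemma natural_conn_eq:
  assumes "smooth_field A X" "smooth_field A Y"
  shows "nab' X Y p = nab X Y p
    + g p (X p) (P p (Y p)) *\<^sub>R \<alpha> p - g p (\<alpha> p) (Y p) *\<^sub>R P p (X p)
    + g p (X p) (Y p) *\<^sub>R \<beta> p - g p (\<beta> p) (Y p) *\<^sub>R X p"
  using assms \<theta>_eq[OF app11_smooth[OF assms(2)]]
  by (simp add: natural_conn_def \<theta>_eq app02_def \<alpha>_def \<beta>_def g_simps g_P_left)
    (simp add: app11_def g_P_left)

lemma natural_conn_linear: "linear_connection A nab'"
  unfolding linear_connection_def
proof (intro conjI allI impI ext)
  fix X Y assume "smooth_field A X" "smooth_field A Y"
  moreover from this have "nab' X Y = (\<lambda>p. nab X Y p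
    + g p (X p) (P p (Y p)) *\<^sub>R \<alpha> p - g p (\<alpha> p) (Y p) *\<^sub>R P p (X p)
    + g p (X p) (Y p) *\<^sub>R \<beta> p - g p (\<beta> p) (Y p) *\<^sub>R X p)"
    using natural_conn_eq by blast
  ultimately show "smooth_field A (nab' X Y)"
    by (simp add: smooth_closure LC.conn_smooth P_smooth g_smooth \<alpha>_smooth \<beta>_smooth)
qed (simp_all add: natural_conn_eq smooth_closure LC.conn_simps g_simps P_simps algebra_simps)

text \<open>The tensor added to the Levi-Civita connection is skew-adjoint.\<close>
lemma natural_conn_metric:
  assumes "smooth_field A X" "smooth_field A Y" "smooth_field A Z"
  shows "dir_deriv A X (\<lambda>q. g q (Y q) (Z q)) p = g p (nab' X Y p) (Z p) + g p (Y p) (nab' X Z p)"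
proof -
  have "g p (Y p) (P p (X p)) = g p (X p) (P p (Y p))" "g p (P p (X p)) (Z p) = g p (X p) (P p (Z p))"
    using g_commute[of p "Y p" "P p (X p)"] by (simp_all add: g_P_left)
  moreover have "g p (Y p) (\<alpha> p) = g p (\<alpha> p) (Y p)" "g p (Y p) (\<beta> p) = g p (\<beta> p) (Y p)"
    "g p (Y p) (X p) = g p (X p) (Y p)"
    by (rule g_commute)+
  ultimately show ?thesis
    using assms by (simp add: natural_conn_eq nab_metric g_simps)
qed

text \<open>The commutator of the added tensor with \<open>P\<close> has the coefficients \<open>\<alpha> - P \<beta> = - \<Omega> / (2n)\<close> and
  \<open>\<beta> - P \<alpha> = P \<Omega> / (2n)\<close>, and the corresponding ones for the two forms; it therefore cancels \<open>\<nabla> P\<close>.\<close>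
lemma natural_conn_parallel:
  assumes "smooth_field A X" "smooth_field A Y"
  shows "nab' X (\<lambda>q. P q (Y q)) p = P p (nab' X Y p)"
proof -
  define \<kappa> where "\<kappa> = 1 / (2 * real n)"
  define t where "t = g p (\<Omega> p) (Y p)"
  define s where "s = g p (\<Omega> p) (P p (Y p))"
  define k where "k = g p (X p) (Y p)"
  define h where "h = g p (X p) (P p (Y p))"
  note defs = \<kappa>_def[symmetric] t_def[symmetric] s_def[symmetric] k_def[symmetric] h_def[symmetric]
  have \<alpha>: "\<alpha> p = lam *\<^sub>R P p (\<Omega> p) + \<mu> *\<^sub>R \<Omega> p" and \<beta>: "\<beta> p = lam *\<^sub>R \<Omega> p + (\<mu> + \<kappa>) *\<^sub>R P p (\<Omega> p)"
    by (simp_all only: \<alpha>_def \<beta>_def \<kappa>_def)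
  have a: "g p (\<alpha> p) (Y p) = lam * s + \<mu> * t" "g p (\<alpha> p) (P p (Y p)) = lam * t + \<mu> * s"
    and b: "g p (\<beta> p) (Y p) = lam * t + (\<mu> + \<kappa>) * s" "g p (\<beta> p) (P p (Y p)) = lam * s + (\<mu> + \<kappa>) * t"
    by (simp_all add: \<alpha> \<beta> g_simps g_P_left P_involution s_def t_def)
  have 1: "nab' X (\<lambda>q. P q (Y q)) p = P p (nab X Y p)
      + \<kappa> *\<^sub>R (k *\<^sub>R \<Omega> p - h *\<^sub>R P p (\<Omega> p) + t *\<^sub>R X p - s *\<^sub>R P p (X p))
      + k *\<^sub>R \<alpha> p - (lam * t + \<mu> * s) *\<^sub>R P p (X p)
      + h *\<^sub>R \<beta> p - (lam * s + (\<mu> + \<kappa>) * t) *\<^sub>R X p"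
    unfolding natural_conn_eq[OF assms(1) P_smooth[OF assms(2)]] nab_P[OF assms] P_involution
      defs a b by (rule refl)
  have 2: "P p (nab' X Y p) = P p (nab X Y p)
      + h *\<^sub>R P p (\<alpha> p) - (lam * s + \<mu> * t) *\<^sub>R X p
      + k *\<^sub>R P p (\<beta> p) - (lam * t + (\<mu> + \<kappa>) * s) *\<^sub>R P p (X p)"
    unfolding natural_conn_eq[OF assms] P_simps defs a b by (rule refl)
  show ?thesis
    unfolding 1 2 by (simp add: \<alpha> \<beta> P_simps algebra_simps)
qed

lemma natural_conn_torsion:
  assumes "smooth_field A X" "smooth_field A Y"
  shows "nab' X Y p - nab' Y X p - lie_bracket A X Y p = tors p (X p) (Y p)"
proof -
  have "g p (Y p) (P p (X p)) = g p (X p) (P p (Y p))"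
    using g_commute[of p "Y p" "P p (X p)"] by (simp add: g_P_left)
  moreover have "g p (Y p) (X p) = g p (X p) (Y p)" by (rule g_commute)
  ultimately show ?thesis using assms by (simp add: natural_conn_eq torsion_free tors_def)
qed

lemma natural_connection: "natural_connection A n P g \<Omega> lam \<mu> nab'"
proof -
  interpret N: smooth_connection A nab' by unfold_locales (rule natural_conn_linear)
  show ?thesis
    by unfold_locales (use natural_conn_metric natural_conn_parallel
        natural_conn_torsion in auto)
qed

end

sublocale W1_natural \<subseteq> N: natural_connection A n P g \<Omega> lam \<mu> "natural_conn n P g nab \<theta> \<Omega> lam \<mu>"
  by (rule natural_connection)

context W1_natural begin

text \<open>As the connection is metric, the covariant derivative commutes with the duality between \<open>\<theta>\<close> and
  \<open>\<Omega>\<close>.\<close>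
lemma cov_deriv_form_eq:
  assumes "smooth_field A X" "smooth_field A W"
  shows "cov_deriv_form A nab' \<theta> X W p = g p (nab' X \<Omega> p) (W p)"
  using assms
  by (simp add: cov_deriv_form_def \<theta>_eq N.conn_smooth natural_conn_metric \<Omega>_smooth)

lemma tensor_U_eq:
  assumes "smooth_field A X" "smooth_field A W"
  shows "tensor_U A n P nab' \<theta> lam \<mu> X W p = g p (nab' X \<beta> p) (W p)"
  using assms
  by (simp add: tensor_U_def cov_deriv_form_eq app11_smooth N.conn_\<beta> g_simps g_P_left)
    (simp add: app11_def)

lemma tensor_V_eq:
  assumes "smooth_field A X" "smooth_field A W"
  shows "tensor_V A P nab' \<theta> lam \<mu> X W p = g p (nab' X \<alpha> p) (W p)"
  using assms
  by (simp add: tensor_V_def cov_deriv_form_eq app11_smooth N.conn_\<alpha> g_simps g_P_left)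
    (simp add: app11_def)

end

theorem proposition4p1:
  fixes A :: "('a::{t2_space,second_countable_topology}, 'm::finite) chart set"
    and n :: nat
    and P :: "('a, 'm) tensor11"
    and g :: "('a, 'm) tensor02"
    and nab nab' :: "('a, 'm) conn"
    and \<theta> :: "('a, 'm) form"
    and \<Omega> :: "('a, 'm) field"
    and lam \<mu> :: real
  assumes "n \<ge> 2"
    and "W1_manifold A n P g nab"
    and "\<theta> = lee_form A P g nab"
    and "dual_field A g \<theta> \<Omega>"
    and "nab' = natural_conn n P g nab \<theta> \<Omega> lam \<mu>"
  shows "riemannian_P_tensor A P (curvature04 A g nab') \<longleftrightarrow>
    (\<forall>Y Z. smooth_field A Y \<longrightarrow> smooth_field A Z \<longrightarrow>
      (\<forall>p.
        tensor_U A n P nab' \<theta> lam \<mu> Y Z p - tensor_U A n P nab' \<theta> lam \<mu> Z Y p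
          + lam / (2 * real n) * (\<theta> (app11 P Y) p * \<theta> Z p - \<theta> Y p * \<theta> (app11 P Z) p) = 0 \<and>
        tensor_V A P nab' \<theta> lam \<mu> Y Z p - tensor_V A P nab' \<theta> lam \<mu> Z Y p
          + \<mu> / (2 * real n) * (\<theta> (app11 P Y) p * \<theta> Z p - \<theta> Y p * \<theta> (app11 P Z) p) = 0))"
proof -
  interpret W1_natural A n P g nab \<theta> \<Omega> lam \<mu>
    using assms(1-4) by unfold_locales
  have w: "wedge_\<theta> p (Y p) (Z p) = \<theta> (app11 P Y) p * \<theta> Z p - \<theta> Y p * \<theta> (app11 P Z) p"
    if "smooth_field A Y" "smooth_field A Z" for Y Z p
    using that by (simp add: wedge_\<theta>_def \<theta>_eq app11_smooth) (simp add: app11_def)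
  show ?thesis
    unfolding assms(5) N.curvature_P_tensor_iff
    by (simp add: N.U_skew_def N.V_skew_def tensor_U_eq tensor_V_eq w)
qed

end
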